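(* Let $\lambda>0$, $\alpha>0$ and let $f\in C^2$ be excessive for $\overline B$, where $\overline B$ is Brownian motion on $\mathbb R^1$ killed after an independent exponential time with parameter $\lambda^2/2$. Let $\overline X_{\alpha,f}=\{\overline X_{\alpha,f}(t),t\in[0,1]\}$ be an $\alpha$-permanental process, with continuous sample paths, with kernel $$\widehat u_f(s,t)=e^{-\lambda|s-t|}+f(t),\qquad s,t\in[0,1].$$ Then $$\limsup_{h\to0}\sup_{0\le t\le h}\frac{|\overline X_{\alpha,f}(t)-\overline X_{\alpha,f}(0)|}{(h\log\log1/h)^{1/2}}\le2\sqrt{2\lambda}\;\overline X_{\alpha,f}^{1/2}(0)\qquad a.s.$$ and, for all $0<T\le1$, $$\limsup_{h\to0}\sup_{\substack{|s-t|\le h\\ s,t\in[0,T]}}\frac{|\overline X_{\alpha,f}(s)-\overline X_{\alpha,f}(t)|}{(h\log1/h)^{1/2}}\le2\sqrt{2\lambda}\,\Big(\sup_{t\in[0,T]}\overline X_{\alpha,f}(t)\Big)^{1/2}\qquad a.s.$$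
   Context: For $\alpha>0$, a random vector $(X_1,\dots,X_n)$ with nonnegative components is $\alpha$-permanental with kernel $U$ (a real $n\times n$ matrix) if $E\big(e^{-\sum_{i=1}^n s_iX_i}\big)=|I+US|^{-\alpha}$ for every diagonal matrix $S$ with positive diagonal entries $s_1,\dots,s_n$, where $|\cdot|$ denotes the determinant. A stochastic process $\{X_\alpha(t),t\in\mathcal T\}$ is an $\alpha$-permanental process with kernel $\{u(s,t),s,t\in\mathcal T\}$ if for all $t_1,\dots,t_n\in\mathcal T$ the vector $(X_\alpha(t_1),\dots,X_\alpha(t_n))$ is $\alpha$-permanental with kernel $\{u(t_i,t_j)\}_{i,j=1}^n$. A function $f$ is excessive for a process with state space $S$ and laws $P^x$ if $f\ge0$ and $E^x(f(X_t))\uparrow f(x)$ as $t\to0$ for all $x\in S$. A function $f\in C^2$ on $\mathbb R^1$ is excessive for $\overline B$ if and only if it is positive and $f''(x)\le\lambda^2f(x)$ for all $x\in\mathbb R^1$; for such $f$, $\widehat u_f$ is the kernel of an $\alpha$-permanental process for all $\alpha>0$. *)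

theory Defs
  imports "HOL-Probability.Probability" "Jordan_Normal_Form.Determinant"
begin

(* The random vector (X 0, ..., X (n - 1)).  An identity with a power of a possibly negative
   determinant needs no separate positivity condition: the left-hand side is positive and
   "0 powr a = 0", so the determinant never vanishes for positive s, and it tends to 1 as s
   tends to 0; hence it is positive and powr is the ordinary real power. *)
definition permanental_vector ::
  "real \<Rightarrow> 'a measure \<Rightarrow> nat \<Rightarrow> (nat \<Rightarrow> 'a \<Rightarrow> real) \<Rightarrow> (nat \<Rightarrow> nat \<Rightarrow> real) \<Rightarrow> bool" where
  "permanental_vector \<alpha> M n X U \<longleftrightarrow>
     prob_space M \<and>
     (\<forall>i<n. X i \<in> borel_measurable M \<and> (AE \<omega> in M. 0 \<le> X i \<omega>)) \<and>
     (\<forall>s. (\<forall>i<n. 0 < s i) \<longrightarrow>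
        (LINT \<omega>|M. exp (- (\<Sum>i<n. s i * X i \<omega>))) =
        Determinant.det (1\<^sub>m n + mat n n (\<lambda>(i, j). U i j) * mat_diag n s) powr (- \<alpha>))"

definition permanental_process ::
  "real \<Rightarrow> 'a measure \<Rightarrow> 't set \<Rightarrow> ('t \<Rightarrow> 'a \<Rightarrow> real) \<Rightarrow> ('t \<Rightarrow> 't \<Rightarrow> real) \<Rightarrow> bool" where
  "permanental_process \<alpha> M T X u \<longleftrightarrow>
     (\<forall>n t. 0 < n \<and> (\<forall>i<n. t i \<in> T) \<longrightarrow>
        permanental_vector \<alpha> M n (\<lambda>i. X (t i)) (\<lambda>i j. u (t i) (t j)))"

(* Standard Brownian motion on the line (variance t at time t) started at x. *)
definition brownian_motion ::
  "'b measure \<Rightarrow> real \<Rightarrow> (real \<Rightarrow> 'b \<Rightarrow> real) \<Rightarrow> bool" where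
  "brownian_motion M x B \<longleftrightarrow>
     prob_space M \<and>
     (\<forall>t\<ge>0. B t \<in> borel_measurable M) \<and>
     (AE \<omega> in M. B 0 \<omega> = x) \<and>
     (\<forall>s t. 0 \<le> s \<and> s < t \<longrightarrow>
        distributed M lborel (\<lambda>\<omega>. B t \<omega> - B s \<omega>) (normal_density 0 (sqrt (t - s)))) \<and>
     (\<forall>n t. 0 \<le> t 0 \<and> strict_mono_on {..n} t \<longrightarrow>
        prob_space.indep_vars M (\<lambda>_. borel) (\<lambda>k \<omega>. B (t (Suc k)) \<omega> - B (t k) \<omega>) {..<n}) \<and>
     (AE \<omega> in M. continuous_on {0..} (\<lambda>t. B t \<omega>))"

(* The process B killed at time \<zeta>; None is the cemetery state. *)
definition killed_at :: "('b \<Rightarrow> real) \<Rightarrow> (real \<Rightarrow> 'b \<Rightarrow> 's) \<Rightarrow> real \<Rightarrow> 'b \<Rightarrow> 's option" where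
  "killed_at \<zeta> B t \<omega> = (if t < \<zeta> \<omega> then Some (B t \<omega>) else None)"

(* Under each law P x, B is a Brownian motion from x and Z is B killed at an exponential time
   with parameter q (mean 1 / q) that is independent of the whole path of B.
   Independence is stated for the generated sigma-algebras because indep_var only covers two random
   variables with values in the same type. *)
definition exp_killed_brownian_motion ::
  "real \<Rightarrow> (real \<Rightarrow> 'b measure) \<Rightarrow> (real \<Rightarrow> 'b \<Rightarrow> real option) \<Rightarrow> bool" where
  "exp_killed_brownian_motion q P Z \<longleftrightarrow>
     (\<exists>B \<zeta>. Z = killed_at \<zeta> B \<and>
        (\<forall>x. brownian_motion (P x) x B \<and>
             distributed (P x) lborel \<zeta> (exponential_density q) \<and>
             prob_space.indep_set (P x)
               (sets (vimage_algebra (space (P x)) \<zeta> borel))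
               (sets (vimage_algebra (space (P x)) (\<lambda>\<omega>. \<lambda>t\<in>{0..}. B t \<omega>)
                  (PiM {0..} (\<lambda>_. borel))))))"

(* The state space is the whole type 's.  As usual, f is extended by 0 to the cemetery state
   None; the expectations are taken in [0, \<infinity>]. *)
definition excessive ::
  "('s::topological_space \<Rightarrow> 'b measure) \<Rightarrow> (real \<Rightarrow> 'b \<Rightarrow> 's option) \<Rightarrow> ('s \<Rightarrow> real) \<Rightarrow> bool" where
  "excessive P Z f \<longleftrightarrow>
     f \<in> borel_measurable borel \<and> (\<forall>x. 0 \<le> f x) \<and>
     (\<forall>x. let E = (\<lambda>t. \<integral>\<^sup>+\<omega>. ennreal (case Z t \<omega> of None \<Rightarrow> 0 | Some y \<Rightarrow> f y) \<partial>P x)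
          in antimono_on {0<..} E \<and> (E \<longlongrightarrow> ennreal (f x)) (at_right 0))"

definition C2 :: "(real \<Rightarrow> real) \<Rightarrow> bool" where
  "C2 f \<longleftrightarrow> (\<forall>x. f differentiable (at x)) \<and> (\<forall>x. deriv f differentiable (at x)) \<and>
     continuous_on UNIV (deriv (deriv f))"

definition u_hat :: "real \<Rightarrow> (real \<Rightarrow> real) \<Rightarrow> real \<Rightarrow> real \<Rightarrow> real" where
  "u_hat lam f s t = exp (- lam * \<bar>s - t\<bar>) + f t"

end

theory Submission
  imports Defs
begin

text \<open>
  Locally, \<open>X\<close> behaves like half of the square of a Gaussian process: its square root has
  increments with Gaussian tails of variance about \<open>lam * \<bar>s - t\<bar>\<close>, and \<open>X s - X t\<close> is about
  \<open>2 * sqrt (X t)\<close> times such an increment. Both bounds are then the classical ones for Gaussian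
  increments. Upper bounds of this kind need nothing but tail estimates for single increments,
  hence only the laws of the pairs \<open>(X s, X t)\<close>, and these are given by a determinant of size two.

  The sharp tail estimate is \<open>permanental_increment_tail\<close>: for \<open>h = \<bar>s - t\<bar>\<close>, the event that
  \<open>X t \<le> m\<close> and \<open>X s - X t \<ge> 2 * sqrt m * x\<close> has a probability of at most a constant times
  \<open>exp (- (1 - \<epsilon>) * x\<^sup>2 / (2 * lam * h))\<close> for small \<open>h\<close> and \<open>x\<close>. It follows from Chebyshev's
  inequality for \<open>exp (a * X s - b * X t)\<close>. The expectation of this variable is a Laplace transform with one
  argument of the wrong sign, and \<open>gamma_laplace_continuation\<close> shows that the determinantal formula
  still holds there. The function \<open>f\<close>, being excessive, is nonnegative, and, being
  \<open>C2\<close>, it is Lipschitz on \<open>{0..1}\<close>; therefore the diagonal entries \<open>1 + f s\<close> and \<open>1 + f t\<close> of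
  the kernel are at least 1 and differ by at most a multiple of \<open>h\<close>, too little to change the
  leading order of the exponent.

  The right-hand sides of the two claims contain \<open>X 0\<close> and the supremum of \<open>X\<close>, so it is enough to
  look at paths below a rational level \<open>m\<close> just above these values. Replacing \<open>X\<close> by
  \<open>min X m / (2 * sqrt (2 * lam) * sqrt m)\<close> gives a process whose increments over a time \<open>h\<close> exceed \<open>g\<close>
  with probability at most a constant times \<open>exp (- (1 - \<epsilon>) * g\<^sup>2 / h)\<close>. For every continuous process with this
  property, a maximal inequality proved by chaining and the Borel-Cantelli lemma along a geometric
  sequence give \<open>law_of_iterated_logarithm\<close> and \<open>levy_modulus\<close> with constant 1. Letting
  \<open>m\<close> decrease to \<open>X 0\<close>, respectively to the supremum, completes the proof.
\<close>

section \<open>Exponential moments from the Laplace transform\<close>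

lemma power_series_eq_0:
  fixes a :: "nat \<Rightarrow> real"
  assumes "0 < r" and "\<And>x. x \<noteq> 0 \<Longrightarrow> \<bar>x\<bar> < r \<Longrightarrow> (\<lambda>n. a n * x ^ n) sums 0"
  shows "a n = 0"
proof -
  have a0: "b 0 = 0" if "\<And>x. x \<noteq> 0 \<Longrightarrow> \<bar>x\<bar> < r \<Longrightarrow> (\<lambda>n. b n * x ^ n) sums 0" for b :: "nat \<Rightarrow> real"
  proof -
    have "((\<lambda>_::real. 0) \<longlongrightarrow> b 0) (at 0)"
      by (rule powser_limit_0_strong[OF assms(1)]) (use that in auto)
    then show ?thesis
      using tendsto_unique[OF _ _ tendsto_const] by (metis trivial_limit_at)
  qed
  show ?thesis
    using assms(2)
  proof (induction n arbitrary: a)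
    case 0
    then show ?case by (rule a0)
  next
    case (Suc n)
    show ?case
    proof (rule Suc.IH[of "\<lambda>n. a (Suc n)"])
      fix x :: real assume x: "x \<noteq> 0" "\<bar>x\<bar> < r"
      have "(\<lambda>n. a (Suc n) * x ^ Suc n) sums (0 - a 0 * x ^ 0)"
        using Suc.prems[OF x] by (subst sums_Suc_iff) simp
      then have "(\<lambda>n. (1 / x) * (a (Suc n) * x ^ Suc n)) sums ((1 / x) * 0)"
        using a0[OF Suc.prems] by (intro sums_mult) simp
      then show "(\<lambda>n. a (Suc n) * x ^ n) sums 0" using x by simp
    qed
  qed
qed

text \<open>
  A variable \<open>Y\<close> whose Laplace transform is that of a gamma law has the exponential moments of
  that law, here under the finite measure with density \<open>W\<close>. Expanding \<open>exp (z * Y)\<close> under the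
  measure tilted by \<open>exp (- Y)\<close> makes the Laplace transform a power series in \<open>z = 1 - p\<close>, which
  must be the binomial series of the closed form. Its coefficients are moments, hence nonnegative,
  so by monotone convergence the identity persists up to the radius of convergence of the binomial
  series, that is beyond \<open>z = 1\<close>, where the exponent \<open>- p = a\<close> is positive.
\<close>

lemma gamma_laplace_continuation:
  fixes Y W :: "'a \<Rightarrow> real" and c \<kappa> \<alpha> a :: real
  assumes [measurable]: "Y \<in> borel_measurable M" and W: "integrable M W"
    and Y0: "AE x in M. 0 \<le> Y x" and W0: "AE x in M. 0 \<le> W x"
    and "0 < \<kappa>" "0 < a" "\<kappa> * a < 1"
    and L: "\<And>p. 0 < p \<Longrightarrow> (LINT x|M. exp (- p * Y x) * W x) = c * (1 + \<kappa> * p) powr (- \<alpha>)"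
  shows "(\<integral>\<^sup>+x. ennreal (exp (a * Y x) * W x) \<partial>M) = ennreal (c * (1 - \<kappa> * a) powr (- \<alpha>))"
proof -
  note [measurable] = borel_measurable_integrable[OF W]
  define V where "V x = exp (- Y x) * W x" for x
  have Vm [measurable]: "V \<in> borel_measurable M" unfolding V_def by measurable
  have expV: "exp (z * Y x) * V x = exp (- (1 - z) * Y x) * W x" for z x
    by (simp add: V_def algebra_simps flip: exp_add exp_diff)
  have exp_sums: "(\<lambda>n. (z * Y x) ^ n / fact n * V x) sums (exp (z * Y x) * V x)" for z x
    using exp_converges[of "z * Y x"] by (intro sums_mult2) (simp add: field_simps)
  have part_le: "(\<Sum>n<N. \<bar>(z * y) ^ n / fact n\<bar>) \<le> exp y" if "\<bar>z\<bar> \<le> 1" "0 \<le> y" for z y :: real and N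
  proof -
    have "(\<Sum>n<N. \<bar>(z * y) ^ n / fact n\<bar>) \<le> (\<Sum>n<N. y ^ n / fact n)"
    proof (rule sum_mono)
      fix n
      have "\<bar>z * y\<bar> ^ n \<le> y ^ n"
        using that mult_right_mono[of "\<bar>z\<bar>" 1 "\<bar>y\<bar>"] by (intro power_mono) (auto simp: abs_mult)
      then show "\<bar>(z * y) ^ n / fact n\<bar> \<le> y ^ n / fact n"
        by (simp add: power_abs divide_right_mono)
    qed
    also have "\<dots> \<le> exp y"
      using exp_converges[of y] that unfolding exp_def
      by (intro order.trans[OF sum_le_suminf[of "\<lambda>n. y ^ n / fact n" "{..<N}"]])
         (auto simp: sums_iff field_simps)
    finally show ?thesis .
  qed
  have V_bound: "AE x in M. \<bar>(z * Y x) ^ n / fact n * V x\<bar> \<le> W x" if "\<bar>z\<bar> \<le> 1" for z n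
    using Y0 W0
  proof eventually_elim
    case (elim x)
    have "\<bar>(z * Y x) ^ n / fact n\<bar> \<le> exp (Y x)"
      using part_le[OF that elim(1), of "Suc n"]
            sum_nonneg[of "{..<n}" "\<lambda>n. \<bar>(z * Y x) ^ n / fact n\<bar>"] by simp
    then have "\<bar>(z * Y x) ^ n / fact n\<bar> * \<bar>V x\<bar> \<le> exp (Y x) * \<bar>V x\<bar>"
      by (rule mult_right_mono) simp
    also have "\<dots> = W x"
      using elim by (simp add: V_def abs_mult flip: exp_add mult.assoc)
    finally show ?case by (simp add: abs_mult)
  qed
  have int: "integrable M (\<lambda>x. (z * Y x) ^ n / fact n * V x)" if "\<bar>z\<bar> \<le> 1" for z n
  proof (rule Bochner_Integration.integrable_bound[OF W])
    show "AE x in M. norm ((z * Y x) ^ n / fact n * V x) \<le> norm (W x)"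
      using V_bound[OF that, of n] W0 by eventually_elim simp
  qed measurable
  \<comment> \<open>\<open>A\<close> and, below, \<open>B\<close> are the coefficients of the transform in powers of \<open>1 - p\<close>, obtained from the
    moments and from the binomial series.\<close>
  define A where "A n = (LINT x|M. Y x ^ n / fact n * V x)" for n
  have A_sums: "(\<lambda>n. A n * z ^ n) sums (c * (1 + \<kappa> * (1 - z)) powr (- \<alpha>))" if "\<bar>z\<bar> < 1" for z
  proof -
    have eq: "(\<Sum>n<N. A n * z ^ n) = (LINT x|M. (\<Sum>n<N. (z * Y x) ^ n / fact n * V x))" for N
    proof -
      have "A n * z ^ n = (LINT x|M. (z * Y x) ^ n / fact n * V x)" for n
        unfolding A_def by (subst integral_mult_left_zero[symmetric])
          (simp add: power_mult_distrib mult_ac)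
      then show ?thesis
        using that by (simp only:) (rule Bochner_Integration.integral_sum[symmetric], rule int, simp)
    qed
    have "(\<lambda>N. LINT x|M. (\<Sum>n<N. (z * Y x) ^ n / fact n * V x))
            \<longlonglongrightarrow> (LINT x|M. exp (z * Y x) * V x)"
    proof (rule integral_dominated_convergence[where w = W])
      show "AE x in M. (\<lambda>N. \<Sum>n<N. (z * Y x) ^ n / fact n * V x) \<longlonglongrightarrow> exp (z * Y x) * V x"
        using exp_sums unfolding sums_def by auto
      show "AE x in M. norm (\<Sum>n<N. (z * Y x) ^ n / fact n * V x) \<le> W x" for N
        using Y0 W0
      proof eventually_elim
        case (elim x)
        have "\<bar>\<Sum>n<N. (z * Y x) ^ n / fact n * V x\<bar> \<le> (\<Sum>n<N. \<bar>(z * Y x) ^ n / fact n * V x\<bar>)"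
          by (rule sum_abs)
        also have "\<dots> = (\<Sum>n<N. \<bar>(z * Y x) ^ n / fact n\<bar>) * \<bar>V x\<bar>"
          by (simp only: abs_mult sum_distrib_right)
        also have "\<dots> \<le> exp (Y x) * \<bar>V x\<bar>"
          using that elim by (intro mult_right_mono part_le) auto
        also have "\<dots> = W x"
          using elim by (simp add: V_def abs_mult flip: exp_add mult.assoc)
        finally show ?case by simp
      qed
    qed (use W in auto)
    then show ?thesis
      using L[of "1 - z"] that unfolding sums_def eq expV by simp
  qed
  define B where "B n = c * (((- \<alpha>) gchoose n) * (1 + \<kappa>) powr (- \<alpha> - of_nat n) * (- \<kappa>) ^ n)" for n
  have B_sums: "(\<lambda>n. B n * z ^ n) sums (c * (1 + \<kappa> * (1 - z)) powr (- \<alpha>))"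
    if "\<bar>\<kappa> * z\<bar> < 1 + \<kappa>" for z
  proof -
    have "\<bar>- \<kappa> * z\<bar> < 1 + \<kappa>" using that by simp
    from sums_mult[OF gen_binomial_real''[OF this, of "- \<alpha>"], of c] show ?thesis
      unfolding B_def by (simp add: power_mult_distrib[of "- \<kappa>" z, simplified] algebra_simps)
  qed
  have AB: "A n = B n" for n
  proof -
    have "(\<lambda>n. A n - B n) n = 0"
    proof (rule power_series_eq_0[of 1])
      fix z :: real assume z: "\<bar>z\<bar> < 1"
      have "\<kappa> * \<bar>z\<bar> < \<kappa> * 1"
        using z \<open>0 < \<kappa>\<close> by (intro mult_strict_left_mono)
      moreover have "\<bar>\<kappa> * z\<bar> = \<kappa> * \<bar>z\<bar>" using \<open>0 < \<kappa>\<close> by (simp add: abs_mult)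
      ultimately have "\<bar>\<kappa> * z\<bar> < 1 + \<kappa>" by linarith
      from sums_diff[OF A_sums[OF z] B_sums[OF this]]
      show "(\<lambda>n. (A n - B n) * z ^ n) sums 0" by (simp add: algebra_simps)
    qed simp
    then show ?thesis by simp
  qed
  have A0: "0 \<le> A n" for n
    unfolding A_def
  proof (rule integral_nonneg_AE)
    show "AE x in M. 0 \<le> Y x ^ n / fact n * V x"
      using Y0 W0 by eventually_elim (simp add: V_def)
  qed
  have "\<bar>\<kappa> * (1 + a)\<bar> < 1 + \<kappa>"
    using \<open>0 < \<kappa>\<close> \<open>0 < a\<close> \<open>\<kappa> * a < 1\<close> by (simp add: abs_mult algebra_simps)
  from B_sums[OF this]
  have S: "(\<lambda>n. A n * (1 + a) ^ n) sums (c * (1 - \<kappa> * a) powr (- \<alpha>))"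
    by (simp add: AB algebra_simps)
  have "(\<integral>\<^sup>+x. ennreal (exp (a * Y x) * W x) \<partial>M)
      = (\<integral>\<^sup>+x. (\<Sum>n. ennreal (Y x ^ n / fact n * V x * (1 + a) ^ n)) \<partial>M)"
  proof (rule nn_integral_cong_AE, use Y0 W0 in eventually_elim)
    case (elim x)
    have "(\<lambda>n. Y x ^ n / fact n * V x * (1 + a) ^ n) sums (exp (a * Y x) * W x)"
      using exp_sums[of "1 + a" x] expV[of "1 + a" x] by (simp add: power_mult_distrib mult_ac)
    then show ?case
      using elim \<open>0 < a\<close> by (subst suminf_ennreal_eq) (auto simp: V_def)
  qed
  also have "\<dots> = (\<Sum>n. \<integral>\<^sup>+x. ennreal (Y x ^ n / fact n * V x * (1 + a) ^ n) \<partial>M)"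
    by (rule nn_integral_suminf) measurable
  also have "\<dots> = (\<Sum>n. ennreal (A n * (1 + a) ^ n))"
  proof (rule suminf_cong)
    fix n
    show "(\<integral>\<^sup>+x. ennreal (Y x ^ n / fact n * V x * (1 + a) ^ n) \<partial>M) = ennreal (A n * (1 + a) ^ n)"
      unfolding A_def
    proof (subst integral_mult_left_zero[symmetric], rule nn_integral_eq_integral)
      show "integrable M (\<lambda>x. Y x ^ n / fact n * V x * (1 + a) ^ n)"
        using int[of 1 n] by (intro integrable_mult_left) simp
      show "AE x in M. 0 \<le> Y x ^ n / fact n * V x * (1 + a) ^ n"
        using Y0 W0 by eventually_elim (use \<open>0 < a\<close> in \<open>simp add: V_def\<close>)
    qed
  qed
  also have "\<dots> = ennreal (c * (1 - \<kappa> * a) powr (- \<alpha>))"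
    using A0 \<open>0 < a\<close> by (intro suminf_ennreal_eq[OF _ S]) auto
  finally show ?thesis .
qed

section \<open>Increments of permanental processes\<close>

lemma det_2x2:
  fixes A :: "'a :: comm_ring_1 mat"
  assumes A: "A \<in> carrier_mat 2 2"
  shows "Determinant.det A = A $$ (0, 0) * A $$ (1, 1) - A $$ (0, 1) * A $$ (1, 0)"
proof -
  have "Determinant.det A = (\<Sum>j<2. A $$ (0, j) * cofactor A 0 j)"
    by (rule laplace_expansion_row[OF A]) simp
  also have "\<dots> = A $$ (0, 0) * cofactor A 0 0 + A $$ (0, 1) * cofactor A 0 1"
    by (simp add: numeral_2_eq_2)
  also have "cofactor A 0 0 = A $$ (1, 1)"
    unfolding cofactor_def by (subst det_single) (use A in \<open>auto simp: mat_delete_def\<close>)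
  also have "cofactor A 0 1 = - A $$ (1, 0)"
    unfolding cofactor_def by (subst det_single) (use A in \<open>auto simp: mat_delete_def\<close>)
  finally show ?thesis by simp
qed

text \<open>
  For two time points the determinant can be written out. The two off-diagonal entries of the kernel
  occur only through their product, so its asymmetry is harmless here.
\<close>

lemma permanental_pair:
  assumes perm: "permanental_process \<alpha> M T X u" and st: "s \<in> T" "t \<in> T"
  shows "prob_space M"
    and "X s \<in> borel_measurable M"
    and "AE \<omega> in M. 0 \<le> X s \<omega>"
    and "\<And>p b. 0 < p \<Longrightarrow> 0 < b \<Longrightarrow>
      (LINT \<omega>|M. exp (- p * X s \<omega>) * exp (- b * X t \<omega>)) =
      ((1 + u s s * p) * (1 + u t t * b) - u s t * u t s * p * b) powr (- \<alpha>)"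
proof -
  define \<tau> where "\<tau> i = (if i = 0 then s else t)" for i :: nat
  have "permanental_vector \<alpha> M 2 (\<lambda>i. X (\<tau> i)) (\<lambda>i j. u (\<tau> i) (\<tau> j))"
    using perm st unfolding permanental_process_def by (simp add: \<tau>_def)
  then have P: "prob_space M"
    "\<forall>i<2. X (\<tau> i) \<in> borel_measurable M \<and> (AE \<omega> in M. 0 \<le> X (\<tau> i) \<omega>)"
    "\<And>v. (\<forall>i<2. 0 < v i) \<Longrightarrow>
        (LINT \<omega>|M. exp (- (\<Sum>i<2. v i * X (\<tau> i) \<omega>))) =
        Determinant.det (1\<^sub>m 2 + mat 2 2 (\<lambda>(i, j). u (\<tau> i) (\<tau> j)) * mat_diag 2 v) powr (- \<alpha>)"
    unfolding permanental_vector_def by blast+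
  show "prob_space M" by (fact P(1))
  have "(0::nat) < 2" by simp
  with P(2) have "X (\<tau> 0) \<in> borel_measurable M \<and> (AE \<omega> in M. 0 \<le> X (\<tau> 0) \<omega>)" by blast
  then show "X s \<in> borel_measurable M" "AE \<omega> in M. 0 \<le> X s \<omega>" by (simp_all add: \<tau>_def)
  show "(LINT \<omega>|M. exp (- p * X s \<omega>) * exp (- b * X t \<omega>)) =
      ((1 + u s s * p) * (1 + u t t * b) - u s t * u t s * p * b) powr (- \<alpha>)"
    if "0 < p" "0 < b" for p b
  proof -
    define v where "v i = (if i = 0 then p else b)" for i :: nat
    have "(LINT \<omega>|M. exp (- p * X s \<omega>) * exp (- b * X t \<omega>)) =
        (LINT \<omega>|M. exp (- (\<Sum>i<2. v i * X (\<tau> i) \<omega>)))"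
      by (rule Bochner_Integration.integral_cong)
         (simp_all add: numeral_2_eq_2 v_def \<tau>_def flip: exp_add)
    also have "\<dots> = Determinant.det (1\<^sub>m 2 + mat 2 2 (\<lambda>(i, j). u (\<tau> i) (\<tau> j)) * mat_diag 2 v) powr (- \<alpha>)"
      using that by (intro P(3)) (simp add: v_def)
    also have "Determinant.det (1\<^sub>m 2 + mat 2 2 (\<lambda>(i, j). u (\<tau> i) (\<tau> j)) * mat_diag 2 v)
             = (1 + u s s * p) * (1 + u t t * b) - u s t * u t s * p * b"
    proof -
      have "1\<^sub>m 2 + mat 2 2 (\<lambda>(i, j). u (\<tau> i) (\<tau> j)) * mat_diag 2 v \<in> carrier_mat 2 2"
        by (intro add_carrier_mat mult_carrier_mat[of _ 2 2 _ 2] mat_diag_dim) auto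
      from det_2x2[OF this] show ?thesis
        by (simp add: mat_diag_mult_right[of _ 2 2] v_def \<tau>_def algebra_simps)
    qed
    finally show ?thesis .
  qed
qed

text \<open>
  This is where the constant \<open>2 * sqrt (2 * lam)\<close> comes from. On \<open>X t \<le> m\<close>, an increment
  \<open>2 * sqrt m * x\<close> of \<open>X\<close> forces an increment of at least about \<open>x\<close> of its square root, which has Gaussian
  tails with variance about \<open>lam * \<bar>s - t\<bar>\<close>. The proof is an exponential Chebyshev inequality for
  \<open>a * X s - b * X t\<close> with \<open>0 < a < b\<close>; restricting to \<open>X t \<le> m\<close> is what makes one pair \<open>(a, b)\<close>
  serve for all values of \<open>X t\<close>. The Lipschitz bound on \<open>f\<close> controls the difference of the diagonal
  entries of the kernel and costs the first factor, which does not depend on \<open>x\<close>.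
\<close>

lemma permanental_increment_tail:
  assumes "0 < lam" "0 < \<alpha>" and perm: "permanental_process \<alpha> M T X (u_hat lam f)"
    and st: "s \<in> T" "t \<in> T" and fst: "0 \<le> f s" "0 \<le> f t" and lip: "\<bar>f s - f t\<bar> \<le> L * \<bar>s - t\<bar>"
    and L: "0 \<le> L" and h: "0 < \<bar>s - t\<bar>" "\<bar>s - t\<bar> \<le> 1" "L * \<bar>s - t\<bar> < 1"
    and m: "0 < m" and x: "0 < x" "x < sqrt m"
  shows "measure M {\<omega> \<in> space M. X t \<omega> \<le> m \<and> 2 * sqrt m * x \<le> X s \<omega> - X t \<omega>}
    \<le> exp (2 * L * m * (1 + lam) / lam) *
       exp (- (1 - x / sqrt m) * x\<^sup>2 / (2 * lam * \<bar>s - t\<bar> * (1 + L * \<bar>s - t\<bar>)))"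
proof -
  interpret prob_space M using permanental_pair(1)[OF perm st] .
  have Xm [measurable]: "X s \<in> borel_measurable M" "X t \<in> borel_measurable M"
    using permanental_pair(2)[OF perm] st by auto
  have X0: "AE \<omega> in M. 0 \<le> X s \<omega>" "AE \<omega> in M. 0 \<le> X t \<omega>"
    using permanental_pair(3)[OF perm] st by auto
  define h where "h = \<bar>s - t\<bar>"
  note h = h[folded h_def] and lip = lip[folded h_def]
  define \<rho> where "\<rho> = exp (- (lam * h))"
  define A where "A = 1 + f s"
  define B where "B = 1 + f t"
  \<comment> \<open>\<open>D\<close> is the determinant of the kernel at \<open>s\<close> and \<open>t\<close>, and \<open>D / A\<close> is \<open>2 * lam * h\<close> to leading
    order.\<close>
  define D where "D = (1 - \<rho>) * (A + B - (1 - \<rho>))"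
  have \<rho>: "0 < \<rho>" "\<rho> < 1" using h \<open>0 < lam\<close> by (auto simp: \<rho>_def)
  have AB: "1 \<le> A" "1 \<le> B" "A - B \<le> L * h" "B - A \<le> L * h" using fst lip by (auto simp: A_def B_def)
  have Lh: "0 \<le> L * h" using L h by simp
  have LhA: "L * h \<le> L * h * A" using mult_left_mono[OF AB(1), of "L * h"] L h by simp
  have laplace: "(LINT \<omega>|M. exp (- p * X s \<omega>) * exp (- b * X t \<omega>)) =
      (1 + A * p + B * b + D * p * b) powr (- \<alpha>)" if "0 < p" "0 < b" for p b
    unfolding permanental_pair(4)[OF perm st that]
    by (simp add: u_hat_def A_def B_def D_def \<rho>_def h_def abs_minus_commute[of t s] algebra_simps)
  have D_lower: "(1 - \<rho>) * A \<le> D"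
    unfolding D_def using \<rho> AB by (intro mult_left_mono) auto
  have D0: "0 < D"
  proof -
    have "0 < (1 - \<rho>) * A" using \<rho> AB by (intro mult_pos_pos) auto
    then show ?thesis using D_lower by linarith
  qed
  have D_upper: "D \<le> 2 * lam * h * (1 + L * h) * A"
  proof -
    have "1 - \<rho> \<le> lam * h" using exp_ge_add_one_self[of "- (lam * h)"] by (simp add: \<rho>_def)
    moreover have "A + B - (1 - \<rho>) \<le> 2 * ((1 + L * h) * A)"
      using \<rho> AB LhA L h by (simp add: algebra_simps)
    ultimately have "D \<le> (lam * h) * (2 * ((1 + L * h) * A))"
      unfolding D_def using \<rho> AB h \<open>0 < lam\<close> by (intro mult_mono) auto
    then show ?thesis by (simp add: mult_ac)
  qed
  have hAD: "h * A / D \<le> (1 + lam) / lam"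
  proof -
    have "exp (lam * h) * \<rho> = 1" by (simp add: \<rho>_def flip: exp_add)
    moreover have "(1 + lam * h) * \<rho> \<le> exp (lam * h) * \<rho>"
      using exp_ge_add_one_self[of "lam * h"] \<rho> by (intro mult_right_mono) auto
    ultimately have "lam * h \<le> (1 + lam * h) * (1 - \<rho>)" by (simp add: algebra_simps)
    also have "\<dots> \<le> (1 + lam) * (1 - \<rho>)"
      using h \<rho> \<open>0 < lam\<close> mult_left_mono[of h 1 lam] by (intro mult_right_mono) auto
    finally have "lam * h * A \<le> (1 + lam) * (1 - \<rho>) * A"
      using AB by (intro mult_right_mono) auto
    also have "\<dots> \<le> (1 + lam) * D"
      using D_lower \<open>0 < lam\<close> by (simp add: mult.assoc)
    finally show ?thesis using D0 \<open>0 < lam\<close> by (simp add: field_simps)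
  qed
  define \<beta> where "\<beta> = x / sqrt m"
  have \<beta>: "0 < \<beta>" "\<beta> < 1" "x = \<beta> * sqrt m" "x\<^sup>2 = \<beta>\<^sup>2 * m"
    using x m by (auto simp: \<beta>_def power_divide)
  \<comment> \<open>For \<open>A = B\<close> and without the factor \<open>1 - L * h\<close>, \<open>a\<close> is the value at which the continued transform of
    \<open>(X s, X t)\<close> equals 1, and this \<open>b\<close> minimises the exponent in Chebyshev's inequality to leading
    order in \<open>\<beta>\<close>. The factor \<open>1 - L * h\<close> absorbs the difference between \<open>A\<close> and \<open>B\<close>.\<close>
  define b where "b = \<beta> * A / D"
  define a where "a = b * (1 - L * h) / (1 + \<beta>)"
  have b0: "0 < b" using \<beta> AB D0 by (simp add: b_def)
  have a0: "0 < a" using b0 \<beta> h by (simp add: a_def)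
  have ab: "a \<le> b"
  proof -
    have "b * (1 - L * h) \<le> b * (1 + \<beta>)" using b0 \<beta> Lh by (intro mult_left_mono) linarith+
    then show ?thesis using \<beta> by (simp add: a_def divide_le_eq)
  qed
  \<comment> \<open>Under the density \<open>exp (- b * X t)\<close>, \<open>X s\<close> has a gamma law with scale \<open>\<kappa>\<close>.\<close>
  define \<kappa> where "\<kappa> = (A + D * b) / (1 + B * b)"
  have Bb: "0 < 1 + B * b" using AB b0 by (simp add: add_pos_pos)
  have \<kappa>0: "0 < \<kappa>" unfolding \<kappa>_def using AB b0 D0 by (intro divide_pos_pos add_pos_pos mult_pos_pos) auto
  have key: "(1 + B * b) * (1 - \<kappa> * a) \<ge> 1"
  proof -
    have "A + D * b = A * (1 + \<beta>)" using D0 by (simp add: b_def algebra_simps)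
    then have "(A + D * b) * a = (A * (1 - L * h)) * b"
      using \<beta> by (simp add: a_def)
    also have "\<dots> \<le> B * b" using LhA AB b0 by (intro mult_right_mono) (auto simp: algebra_simps)
    finally have "1 \<le> 1 + B * b - (A + D * b) * a" by simp
    also have "\<dots> = (1 + B * b) * (1 - \<kappa> * a)" using Bb by (simp add: \<kappa>_def field_simps)
    finally show ?thesis by simp
  qed
  then have \<kappa>a: "\<kappa> * a < 1"
    using Bb by (smt (verit) mult_nonneg_nonpos)
  have lap: "(LINT \<omega>|M. exp (- p * X s \<omega>) * exp (- b * X t \<omega>)) =
      (1 + B * b) powr (- \<alpha>) * (1 + \<kappa> * p) powr (- \<alpha>)" if "0 < p" for p
  proof -
    have "1 + A * p + B * b + D * p * b = (1 + B * b) * (1 + \<kappa> * p)"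
      using Bb by (simp add: \<kappa>_def field_simps)
    then show ?thesis
      unfolding laplace[OF that b0] using Bb \<kappa>0 that by (simp add: powr_mult add_pos_pos)
  qed
  have int: "integrable M (\<lambda>\<omega>. exp (- b * X t \<omega>))"
    by (rule integrable_const_bound[where B = 1]) (use X0(2) b0 in \<open>auto elim!: eventually_mono\<close>)
  have "(1 + B * b) powr (- \<alpha>) * (1 - \<kappa> * a) powr (- \<alpha>) = inverse (((1 + B * b) * (1 - \<kappa> * a)) powr \<alpha>)"
    using Bb \<kappa>a by (simp add: powr_mult powr_minus)
  also have "\<dots> \<le> 1"
    using key \<open>0 < \<alpha>\<close> by (intro inverse_le_1_iff[THEN iffD2] disjI2 ge_one_powr_ge_zero) auto
  finally have le1: "(1 + B * b) powr (- \<alpha>) * (1 - \<kappa> * a) powr (- \<alpha>) \<le> 1" .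
  have "(\<integral>\<^sup>+\<omega>. ennreal (exp (a * X s \<omega>) * exp (- b * X t \<omega>)) \<partial>M)
      = ennreal ((1 + B * b) powr (- \<alpha>) * (1 - \<kappa> * a) powr (- \<alpha>))"
    by (rule gamma_laplace_continuation[OF _ int X0(1) _ \<kappa>0 a0 \<kappa>a lap]) auto
  also have "\<dots> \<le> 1"
    using le1 by (simp only: ennreal_le_1)
  finally have mgf: "(\<integral>\<^sup>+\<omega>. ennreal (exp (a * X s \<omega>) * exp (- b * X t \<omega>)) \<partial>M) \<le> 1" .
  define y where "y = 2 * sqrt m * x"
  have y: "y = 2 * \<beta> * m" using m by (simp add: y_def \<beta>(3))
  define E where "E = (b - a) * m - a * y"
  have "emeasure M {\<omega> \<in> space M. X t \<omega> \<le> m \<and> y \<le> X s \<omega> - X t \<omega>}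
      \<le> emeasure M {\<omega> \<in> space M. 1 \<le> ennreal (exp E) * ennreal (exp (a * X s \<omega>) * exp (- b * X t \<omega>))}"
  proof (rule emeasure_mono)
    show "{\<omega> \<in> space M. X t \<omega> \<le> m \<and> y \<le> X s \<omega> - X t \<omega>}
      \<subseteq> {\<omega> \<in> space M. 1 \<le> ennreal (exp E) * ennreal (exp (a * X s \<omega>) * exp (- b * X t \<omega>))}"
    proof safe
      fix \<omega> assume \<omega>: "X t \<omega> \<le> m" "y \<le> X s \<omega> - X t \<omega>"
      have "(b - a) * X t \<omega> \<le> (b - a) * m" using \<omega> ab by (intro mult_left_mono) auto
      moreover have "a * y \<le> a * (X s \<omega> - X t \<omega>)" using \<omega> a0 by (intro mult_left_mono) auto
      ultimately have "0 \<le> E + (a * X s \<omega> + - b * X t \<omega>)" by (simp add: E_def algebra_simps)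
      then have "1 \<le> exp (E + (a * X s \<omega> + - b * X t \<omega>))" by simp
      then show "1 \<le> ennreal (exp E) * ennreal (exp (a * X s \<omega>) * exp (- b * X t \<omega>))"
        by (simp only: exp_add ennreal_mult'[symmetric] exp_ge_zero ennreal_1[symmetric])
           (rule ennreal_leI)
    qed
  qed measurable
  also have "\<dots> \<le> ennreal (exp E) *
      (\<integral>\<^sup>+\<omega>. ennreal (exp (a * X s \<omega>) * exp (- b * X t \<omega>)) * indicator (space M) \<omega> \<partial>M)"
    by (rule nn_integral_Markov_inequality) auto
  also have "(\<integral>\<^sup>+\<omega>. ennreal (exp (a * X s \<omega>) * exp (- b * X t \<omega>)) * indicator (space M) \<omega> \<partial>M)
      = (\<integral>\<^sup>+\<omega>. ennreal (exp (a * X s \<omega>) * exp (- b * X t \<omega>)) \<partial>M)"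
    by (rule nn_integral_cong) simp
  also have "ennreal (exp E) * \<dots> \<le> ennreal (exp E) * 1"
    using mgf by (rule mult_left_mono) simp
  finally have "prob {\<omega> \<in> space M. X t \<omega> \<le> m \<and> y \<le> X s \<omega> - X t \<omega>} \<le> exp E"
    by (simp add: emeasure_eq_measure)
  also have "E \<le> 2 * L * m * (1 + lam) / lam + - (1 - x / sqrt m) * x\<^sup>2 / (2 * lam * h * (1 + L * h))"
  proof -
    have "E = b * m * (1 - (1 + 2 * \<beta>) * (1 - L * h) / (1 + \<beta>))"
    proof -
      have "E = b * m - a * (m * (1 + 2 * \<beta>))" by (simp add: E_def y algebra_simps)
      also have "a * (m * (1 + 2 * \<beta>)) = b * m * ((1 + 2 * \<beta>) * (1 - L * h) / (1 + \<beta>))"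
        by (simp add: a_def)
      finally show ?thesis by (simp add: right_diff_distrib)
    qed
    also have "\<dots> \<le> b * m * (2 * (L * h) - \<beta> * (1 - \<beta>))"
    proof (rule mult_left_mono)
      have "0 \<le> L * h + \<beta> * \<beta> * \<beta>" using L h \<beta> by simp
      then have "(1 - (2 * (L * h) - \<beta> * (1 - \<beta>))) * (1 + \<beta>) \<le> (1 + 2 * \<beta>) * (1 - L * h)"
        by (simp add: algebra_simps)
      then have "1 - (2 * (L * h) - \<beta> * (1 - \<beta>)) \<le> (1 + 2 * \<beta>) * (1 - L * h) / (1 + \<beta>)"
        using \<beta> by (subst pos_le_divide_eq) auto
      then show "1 - (1 + 2 * \<beta>) * (1 - L * h) / (1 + \<beta>) \<le> 2 * (L * h) - \<beta> * (1 - \<beta>)" by linarith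
    qed (use b0 m in simp)
    also have "\<dots> = 2 * L * m * (\<beta> * (h * A / D)) - (1 - \<beta>) * x\<^sup>2 * (A / D)"
      unfolding \<beta>(4) b_def by (simp add: power2_eq_square algebra_simps)
    also have "\<dots> \<le> 2 * L * m * ((1 + lam) / lam) - (1 - \<beta>) * x\<^sup>2 * (1 / (2 * lam * h * (1 + L * h)))"
    proof (rule diff_mono)
      have "\<beta> * (h * A / D) \<le> 1 * ((1 + lam) / lam)"
        using hAD \<beta> h AB D0 by (intro mult_mono) auto
      then show "2 * L * m * (\<beta> * (h * A / D)) \<le> 2 * L * m * ((1 + lam) / lam)"
        using L m by (intro mult_left_mono) auto
      have pos: "0 < 2 * lam * h * (1 + L * h)" using h L \<open>0 < lam\<close> by (simp add: add_pos_nonneg)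
      have "1 / (2 * lam * h * (1 + L * h)) \<le> A / D"
        using D_upper D0 pos by (simp add: divide_simps mult_ac)
      then show "(1 - \<beta>) * x\<^sup>2 * (1 / (2 * lam * h * (1 + L * h))) \<le> (1 - \<beta>) * x\<^sup>2 * (A / D)"
        using \<beta>(1,2) by (intro mult_left_mono mult_nonneg_nonneg) auto
    qed
    also have "\<dots> = 2 * L * m * (1 + lam) / lam + - (1 - x / sqrt m) * x\<^sup>2 / (2 * lam * h * (1 + L * h))"
      by (simp only: \<beta>_def[symmetric] times_divide_eq_right mult_1_right mult_minus_left
          minus_divide_left[symmetric] diff_conv_add_uminus[symmetric])
    finally show ?thesis .
  qed
  finally show ?thesis unfolding y_def h_def exp_add by simp
qed

section \<open>Processes with sub-Gaussian increments: the maximal inequality\<close>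

text \<open>
  Round \<open>t\<close> down to the grid of mesh \<open>w / 2 ^ p\<close>. Passing from one level to the next either keeps the
  point or moves it by one step from an even to an odd grid point, so only these steps need a bound.
  Rounding down also keeps all points in \<open>{u..t}\<close>.
\<close>

lemma dyadic_chaining:
  fixes g :: "real \<Rightarrow> real"
  assumes cont: "continuous_on {0..} g" and "0 \<le> u" "0 < w" "u \<le> t" "t \<le> u + real n * w"
    and step: "\<And>p k. k \<le> n * 2 ^ p \<Longrightarrow>
      \<bar>g (u + real (2 * k + 1) * (w / 2 ^ Suc p)) - g (u + real (2 * k) * (w / 2 ^ Suc p))\<bar> \<le> c p"
    and S: "\<And>m. (\<Sum>p<m. c p) \<le> S"
  shows "\<exists>k\<le>n. \<bar>g t - g (u + real k * w)\<bar> \<le> S"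
proof -
  define z where "z p = (t - u) * 2 ^ p / w" for p :: nat
  define \<kappa> where "\<kappa> p = nat \<lfloor>z p\<rfloor>" for p
  define \<tau> where "\<tau> p = u + real (\<kappa> p) * (w / 2 ^ p)" for p
  have z0: "0 \<le> z p" for p unfolding z_def using assms by simp
  have zn: "z p \<le> real (n * 2 ^ p)" for p
  proof -
    have "(t - u) * 2 ^ p \<le> (real n * w) * 2 ^ p" using assms by (intro mult_right_mono) auto
    then show ?thesis unfolding z_def using \<open>0 < w\<close> by (simp add: field_simps)
  qed
  have \<kappa>_le: "real (\<kappa> p) \<le> z p" and \<kappa>_gt: "z p < real (\<kappa> p) + 1" for p
    using z0[of p] unfolding \<kappa>_def by linarith+
  have \<kappa>n: "\<kappa> p \<le> n * 2 ^ p" for p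
    using \<kappa>_le[of p] zn[of p] of_nat_le_iff[where 'a = real] by (metis order.trans)
  have \<kappa>_Suc: "\<kappa> (Suc p) = 2 * \<kappa> p \<or> \<kappa> (Suc p) = 2 * \<kappa> p + 1" for p
  proof -
    have "z (Suc p) = 2 * z p" by (simp add: z_def)
    then have "real (\<kappa> (Suc p)) < real (2 * \<kappa> p + 2)" "real (2 * \<kappa> p) < real (\<kappa> (Suc p) + 1)"
      using \<kappa>_le[of p] \<kappa>_gt[of p] \<kappa>_le[of "Suc p"] \<kappa>_gt[of "Suc p"] by auto
    then have "\<kappa> (Suc p) < 2 * \<kappa> p + 2" "2 * \<kappa> p < \<kappa> (Suc p) + 1" by (simp_all only: of_nat_less_iff)
    then show ?thesis by linarith
  qed
  have c0: "0 \<le> c p" for p using step[of 0 p] by linarith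
  have \<tau>_step: "\<bar>g (\<tau> (Suc p)) - g (\<tau> p)\<bar> \<le> c p" for p
  proof -
    have eq: "\<tau> p = u + real (2 * \<kappa> p) * (w / 2 ^ Suc p)" by (simp add: \<tau>_def)
    from \<kappa>_Suc[of p] show ?thesis
    proof
      assume "\<kappa> (Suc p) = 2 * \<kappa> p"
      then have "\<tau> (Suc p) = \<tau> p" using eq by (simp only: \<tau>_def)
      then show ?thesis using c0 by simp
    next
      assume "\<kappa> (Suc p) = 2 * \<kappa> p + 1"
      then have "\<tau> (Suc p) = u + real (2 * \<kappa> p + 1) * (w / 2 ^ Suc p)" by (simp only: \<tau>_def)
      then show ?thesis using step[OF \<kappa>n[of p]] eq by (simp only:)
    qed
  qed
  have tele: "\<bar>g (\<tau> m) - g (\<tau> 0)\<bar> \<le> (\<Sum>p<m. c p)" for m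
  proof (induction m)
    case (Suc m)
    then show ?case using \<tau>_step[of m] by simp
  qed simp
  have dist: "\<bar>\<tau> p - t\<bar> \<le> w * (1 / 2) ^ p" for p
  proof -
    have "t = u + z p * (w / 2 ^ p)" using \<open>0 < w\<close> by (simp add: z_def)
    then have "\<tau> p - t = (real (\<kappa> p) - z p) * (w / 2 ^ p)" by (simp add: \<tau>_def algebra_simps diff_divide_distrib)
    then have "\<bar>\<tau> p - t\<bar> = \<bar>real (\<kappa> p) - z p\<bar> * (w / 2 ^ p)" using \<open>0 < w\<close> by (simp add: abs_mult)
    also have "\<dots> \<le> 1 * (w / 2 ^ p)"
      using \<kappa>_le[of p] \<kappa>_gt[of p] \<open>0 < w\<close> by (intro mult_right_mono) auto
    finally show ?thesis by (simp add: power_one_over)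
  qed
  have \<tau>_lim: "\<tau> \<longlonglongrightarrow> t"
  proof (rule LIM_zero_cancel, rule Lim_null_comparison)
    show "\<forall>\<^sub>F p in sequentially. norm (\<tau> p - t) \<le> w * (1 / 2) ^ p" using dist by simp
    show "(\<lambda>p. w * (1 / 2) ^ p) \<longlonglongrightarrow> 0" by (intro tendsto_mult_right_zero LIMSEQ_power_zero) simp
  qed
  have "(\<lambda>p. g (\<tau> p)) \<longlonglongrightarrow> g t"
    by (rule continuous_on_tendsto_compose[OF cont \<tau>_lim])
       (use assms in \<open>auto simp: \<tau>_def\<close>)
  then have "(\<lambda>p. \<bar>g (\<tau> p) - g (\<tau> 0)\<bar>) \<longlonglongrightarrow> \<bar>g t - g (\<tau> 0)\<bar>"
    by (intro tendsto_intros)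
  then have "\<bar>g t - g (\<tau> 0)\<bar> \<le> S"
    by (rule LIMSEQ_le_const2) (use order.trans[OF tele S] in auto)
  then show ?thesis using \<kappa>n[of 0] by (intro exI[of _ "\<kappa> 0"]) (simp add: \<tau>_def)
qed

text \<open>
  Up to an arbitrarily small loss in the exponent, a small increment over a time \<open>h\<close> has the tails of a
  centred Gaussian variable of variance \<open>h / 2\<close>. With this normalisation the constants in the upper bounds of the
  law of the iterated logarithm and of Levy's modulus of continuity are both 1. The bound is
  required only for small \<open>g\<close>, which is all that the truncated permanental processes provide.
\<close>

locale subgaussian_increments = prob_space M for M :: "'a measure" +
  fixes G :: "real \<Rightarrow> 'a \<Rightarrow> real"
  assumes measurable_G [measurable]: "\<And>t. G t \<in> borel_measurable M"
    and increment_tail: "\<And>\<epsilon>. 0 < \<epsilon> \<Longrightarrow> \<epsilon> < 1 \<Longrightarrow> \<exists>C \<delta>. 0 < C \<and> 0 < \<delta> \<and>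
      (\<forall>s t h g. 0 \<le> s \<longrightarrow> 0 \<le> t \<longrightarrow> \<bar>s - t\<bar> \<le> h \<longrightarrow> 0 < h \<longrightarrow> h \<le> \<delta> \<longrightarrow> 0 < g \<longrightarrow> g \<le> \<delta> \<longrightarrow>
        prob {\<omega> \<in> space M. g \<le> \<bar>G s \<omega> - G t \<omega>\<bar>} \<le> C * exp (- (1 - \<epsilon>) * g\<^sup>2 / h))"
begin

text \<open>
  The supremum of \<open>\<bar>G t - G u\<bar>\<close> over an interval of length \<open>h\<close> has nearly the same tail as a single
  increment. A fixed number \<open>n\<close> of equidistant points carries the sharp constant, since a union bound
  over them costs only a factor \<open>n\<close>. Between these points, chaining is
  wasteful by a constant factor, but the increments there are smaller by a factor \<open>1 / sqrt n\<close>, which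
  compensates for the waste once \<open>n\<close> is large. Working outside an exceptional set \<open>N\<close> avoids the
  question whether the supremum is measurable.
\<close>

lemma maximal_inequality:
  assumes "0 < \<epsilon>" "\<epsilon> \<le> 1"
  obtains C \<delta> where "0 < C" "0 < \<delta>"
    "\<forall>u h l. 0 \<le> u \<longrightarrow> 0 < h \<longrightarrow> h \<le> \<delta> \<longrightarrow> 1 \<le> l \<longrightarrow> h * l \<le> \<delta> \<longrightarrow>
      (\<exists>N\<in>sets M. prob N \<le> C * exp (- (1 + \<epsilon>) * l) \<and>
        (\<forall>\<omega>\<in>space M - N. continuous_on {0..} (\<lambda>t. G t \<omega>) \<longrightarrow>
          (\<forall>t\<in>{u..u + h}. \<bar>G t \<omega> - G u \<omega>\<bar> \<le> (1 + 2 * \<epsilon>) * sqrt (h * l))))"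
proof -
  \<comment> \<open>With this loss in the exponent, \<open>(1 - e) * (1 + \<epsilon>)\<^sup>2 = 1 + \<epsilon>\<close>.\<close>
  define e where "e = \<epsilon> / (1 + \<epsilon>)"
  have e: "0 < e" "e \<le> 1 / 2" "e < 1" "1 - e = 1 / (1 + \<epsilon>)"
    using assms by (auto simp: e_def field_simps)
  obtain C0 d0 where C0: "0 < C0" and d0: "0 < d0" and
    tail: "\<And>s t h g. \<lbrakk>0 \<le> s; 0 \<le> t; \<bar>s - t\<bar> \<le> h; 0 < h; h \<le> d0; 0 < g; g \<le> d0\<rbrakk> \<Longrightarrow>
        prob {\<omega> \<in> space M. g \<le> \<bar>G s \<omega> - G t \<omega>\<bar>} \<le> C0 * exp (- (1 - e) * g\<^sup>2 / h)"
    using increment_tail[OF e(1,3)] by blast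
  \<comment> \<open>The thresholds \<open>c p\<close> below sum to at most \<open>4 * sqrt (32 / n) * r\<close>, which is then below \<open>\<epsilon> * r\<close>.\<close>
  obtain n :: nat where n: "512 / \<epsilon>\<^sup>2 < real n" using reals_Archimedean2 by blast
  have "0 \<le> 512 / \<epsilon>\<^sup>2" by simp
  with n have n0: "0 < real n" by linarith
  define \<delta> where "\<delta> = min d0 (d0\<^sup>2 / 32)"
  have \<delta>0: "0 < \<delta>" using d0 by (simp add: \<delta>_def)
  show thesis
  proof (rule that[of "5 * real n * C0" \<delta>], goal_cases)
    case 1
    show "0 < 5 * real n * C0" using n0 C0 by simp
  next
    case 2
    show "0 < \<delta>" by fact
  next
    case 3
    show ?case
    proof (intro allI impI)
    fix u h l :: real
    assume u: "0 \<le> u" and h: "0 < h" "h \<le> \<delta>" and l: "1 \<le> l" and hl: "h * l \<le> \<delta>"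
    define w where "w = h / real n"
    have w: "0 < w" "real n * w = h" using h n0 by (auto simp: w_def)
    define r where "r = sqrt (h * l)"
    have r: "0 < r" "r\<^sup>2 = h * l" using h l by (auto simp: r_def)
    have rd: "sqrt 32 * r \<le> d0"
    proof (rule power2_le_imp_le)
      show "(sqrt 32 * r)\<^sup>2 \<le> d0\<^sup>2" using r hl by (simp add: power_mult_distrib \<delta>_def)
    qed (use d0 in simp)
    \<comment> \<open>The ratio \<open>3 / 4\<close> makes the thresholds summable but exceeds \<open>1 / sqrt 2\<close>, so that
      \<open>(c p)\<^sup>2\<close> divided by the mesh \<open>w / 2 ^ Suc p\<close> is \<open>64 * l * (9 / 8) ^ p\<close>, large enough to
      beat the number of intervals at level \<open>p\<close>.\<close>
    define c where "c p = sqrt 32 * r / sqrt (real n) * (3 / 4) ^ p" for p :: nat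
    have c0: "0 < c p" for p using r n0 by (simp add: c_def)
    define A where "A k = {\<omega> \<in> space M. (1 + \<epsilon>) * r \<le> \<bar>G (u + real k * w) \<omega> - G u \<omega>\<bar>}" for k :: nat
    define D where "D p k = {\<omega> \<in> space M. c p \<le>
      \<bar>G (u + real (2 * k + 1) * (w / 2 ^ Suc p)) \<omega> - G (u + real (2 * k) * (w / 2 ^ Suc p)) \<omega>\<bar>}"
      for p k :: nat
    have [measurable]: "A k \<in> sets M" "D p k \<in> sets M" for p k
      unfolding A_def D_def by measurable
    define DD where "DD p = (\<Union>k\<in>{..n * 2 ^ p}. D p k)" for p
    have [measurable]: "DD p \<in> sets M" for p unfolding DD_def by measurable
    define N where "N = (\<Union>k\<in>{1..n}. A k) \<union> (\<Union>p. DD p)"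
    have Nm: "N \<in> sets M" unfolding N_def by measurable
    have PA: "prob (A k) \<le> C0 * exp (- (1 + \<epsilon>) * l)" if "k \<in> {1..n}" for k
    proof -
      have "real k * w \<le> real n * w" using that w by (intro mult_right_mono) auto
      then have "\<bar>u + real k * w - u\<bar> \<le> h" using w by simp
      moreover have "(1 + \<epsilon>) * r \<le> d0"
      proof -
        have "2 \<le> sqrt (32 :: real)" by (rule real_le_rsqrt) simp
        then have "(1 + \<epsilon>) * r \<le> sqrt 32 * r"
          using assms r by (intro mult_right_mono) auto
        then show ?thesis using rd by linarith
      qed
      ultimately have "prob (A k) \<le> C0 * exp (- (1 - e) * ((1 + \<epsilon>) * r)\<^sup>2 / h)"
        unfolding A_def using h u w r assms by (intro tail) (auto simp: \<delta>_def)
      also have "- (1 - e) * ((1 + \<epsilon>) * r)\<^sup>2 / h = - (1 + \<epsilon>) * l"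
        unfolding e(4) power_mult_distrib r(2) using h assms
        by (simp add: power2_eq_square) (simp add: algebra_simps)
      finally show ?thesis .
    qed
    have PD: "prob (D p k) \<le> C0 * (exp (- 2 * l) * (1 / 4) ^ p)" for p k
    proof -
      define hp where "hp = w / 2 ^ Suc p"
      have hp: "0 < hp" "hp \<le> h"
      proof -
        show "0 < hp" using w by (simp add: hp_def)
        have "w * 1 \<le> w * real n" using n0 w by (intro mult_left_mono) auto
        moreover have "w * 1 \<le> w * 2 ^ Suc p"
          using w one_le_power[of "2::real" "Suc p"] by (intro mult_left_mono) auto
        then have "hp \<le> w" by (simp add: hp_def field_simps)
        ultimately show "hp \<le> h" using w(2) by (simp add: mult.commute)
      qed
      have "c p \<le> sqrt 32 * r"
      proof -
        have "(3 / 4 :: real) ^ p \<le> 1" by (intro power_le_one) auto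
        moreover have "1 \<le> sqrt (real n)" using n0 by simp
        ultimately have "(3 / 4) ^ p \<le> sqrt (real n)" by linarith
        then have "(sqrt 32 * r) * ((3 / 4) ^ p / sqrt (real n)) \<le> (sqrt 32 * r) * 1"
          using r n0 by (intro mult_left_mono) auto
        then show ?thesis by (simp add: c_def)
      qed
      then have "prob (D p k) \<le> C0 * exp (- (1 - e) * (c p)\<^sup>2 / hp)"
        unfolding D_def hp_def[symmetric] using hp h u c0[of p] rd
        by (intro tail) (auto simp: \<delta>_def algebra_simps)
      also have "- (1 - e) * (c p)\<^sup>2 / hp \<le> - 2 * l - 2 * real p"
      proof -
        have "((3 / 4 :: real) ^ p)\<^sup>2 * 2 ^ p = (9 / 8) ^ p"
          by (simp add: power2_eq_square flip: power_mult_distrib)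
        then have "(c p)\<^sup>2 / hp = 64 * l * (9 / 8) ^ p"
          using r(2) n0 h by (simp add: c_def hp_def w_def power_mult_distrib power_divide field_simps)
        moreover have "1 + real p * (1 / 8) \<le> (1 + 1 / 8) ^ p"
          by (rule Bernoulli_inequality) simp
        then have "64 * l * (1 + real p * (1 / 8)) \<le> 64 * l * (9 / 8) ^ p"
          using l by (intro mult_left_mono) auto
        moreover have "2 * real p \<le> 4 * (l * real p)" using l mult_right_mono[of 1 l "real p"] by simp
        ultimately have *: "4 * l + 4 * real p \<le> (c p)\<^sup>2 / hp" using l by (simp add: algebra_simps)
        define q where "q = (1 - e) * ((c p)\<^sup>2 / hp)"
        have q: "(1 / 2) * (4 * l + 4 * real p) \<le> q"
          unfolding q_def using * e(1-3) l by (intro mult_mono) auto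
        have "- (1 - e) * (c p)\<^sup>2 / hp = - q"
          unfolding q_def by (simp only: mult_minus_left minus_divide_left times_divide_eq_right)
        also have "\<dots> \<le> - 2 * l - 2 * real p" using q by simp
        finally show ?thesis .
      qed
      also have "exp (- 2 * l - 2 * real p) = exp (- 2 * l) * exp (- 2) ^ p"
      proof -
        have "- 2 * l - 2 * real p = - 2 * l + real p * (- 2)" by simp
        then show ?thesis by (simp only: exp_add exp_of_nat_mult)
      qed
      also have "\<dots> \<le> exp (- 2 * l) * (1 / 4) ^ p"
      proof (intro mult_left_mono power_mono)
        have "(2 :: real) * 2 \<le> exp 1 * exp 1" using exp_ge_add_one_self[of 1] by (intro mult_mono) auto
        then show "exp (- 2) \<le> (1 / 4 :: real)" by (simp add: exp_minus field_simps flip: exp_add)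
      qed auto
      finally show ?thesis using C0 by simp
    qed
    have PDD: "prob (DD p) \<le> 2 * real n * C0 * exp (- 2 * l) * (1 / 2) ^ p" for p
    proof -
      have "prob (DD p) \<le> (\<Sum>k\<in>{..n * 2 ^ p}. prob (D p k))"
        unfolding DD_def by (rule finite_measure_subadditive_finite) auto
      also have "\<dots> \<le> real (card {..n * 2 ^ p}) * (C0 * (exp (- 2 * l) * (1 / 4) ^ p))"
        using PD by (intro sum_bounded_above) auto
      also have "real (card {..n * 2 ^ p}) \<le> 2 * real n * 2 ^ p"
      proof -
        have "(1 :: real) * 1 \<le> real n * 2 ^ p" using n0 by (intro mult_mono) auto
        then show ?thesis by simp
      qed
      also have "2 * real n * 2 ^ p * (C0 * (exp (- 2 * l) * (1 / 4) ^ p))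
               = 2 * real n * C0 * exp (- 2 * l) * (1 / 2) ^ p"
        by (simp add: power_divide field_simps flip: power_mult_distrib)
      finally show ?thesis using C0 by simp
    qed
    have geom: "(\<lambda>p. 2 * real n * C0 * exp (- 2 * l) * (1 / 2) ^ p) sums (2 * real n * C0 * exp (- 2 * l) * 2)"
      using geometric_sums[of "1 / 2 :: real"] by (intro sums_mult) simp
    have sumDD: "summable (\<lambda>p. prob (DD p))"
      by (rule summable_comparison_test'[OF sums_summable[OF geom], of 0]) (use PDD in auto)
    have "prob (\<Union>p. DD p) \<le> (\<Sum>p. prob (DD p))"
      by (rule finite_measure_subadditive_countably) (use sumDD in auto)
    also have "\<dots> \<le> 2 * real n * C0 * exp (- 2 * l) * 2"
      using suminf_le[OF PDD sumDD sums_summable[OF geom]] sums_unique[OF geom] by simp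
    also have "\<dots> \<le> 4 * real n * C0 * exp (- (1 + \<epsilon>) * l)"
    proof -
      have "(1 + \<epsilon>) * l \<le> 2 * l" using l assms by (intro mult_right_mono) auto
      then have "exp (- 2 * l) \<le> exp (- (1 + \<epsilon>) * l)"
        unfolding exp_le_cancel_iff mult_minus_left by simp
      then have "(4 * real n * C0) * exp (- 2 * l) \<le> (4 * real n * C0) * exp (- (1 + \<epsilon>) * l)"
        using n0 C0 by (intro mult_left_mono) auto
      then show ?thesis by (simp add: mult_ac)
    qed
    finally have P2: "prob (\<Union>p. DD p) \<le> 4 * real n * C0 * exp (- (1 + \<epsilon>) * l)" .
    have "prob (\<Union>k\<in>{1..n}. A k) \<le> (\<Sum>k\<in>{1..n}. prob (A k))"
      by (rule finite_measure_subadditive_finite) auto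
    also have "\<dots> \<le> real (card {1..n}) * (C0 * exp (- (1 + \<epsilon>) * l))"
      using PA by (intro sum_bounded_above) auto
    finally have P1: "prob (\<Union>k\<in>{1..n}. A k) \<le> real n * C0 * exp (- (1 + \<epsilon>) * l)" by simp
    have "prob N \<le> prob (\<Union>k\<in>{1..n}. A k) + prob (\<Union>p. DD p)"
      unfolding N_def by (rule measure_Un_le) auto
    with P1 P2 have PN: "prob N \<le> 5 * real n * C0 * exp (- (1 + \<epsilon>) * l)" by simp
    have sumc: "(\<Sum>p<m. c p) \<le> \<epsilon> * r" for m
    proof -
      have "(\<Sum>p<m. (3 / 4 :: real) ^ p) = 4 * (1 - (3 / 4) ^ m)"
        by (subst sum_gp_strict) simp
      also have "\<dots> \<le> 4" by simp
      finally have "(\<Sum>p<m. c p) \<le> sqrt 32 * r / sqrt (real n) * 4"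
        unfolding c_def sum_distrib_left[symmetric] using r n0 by (intro mult_left_mono) auto
      also have "\<dots> = (4 * sqrt 32 / sqrt (real n)) * r" by simp
      also have "\<dots> \<le> \<epsilon> * r"
      proof (rule mult_right_mono, rule power2_le_imp_le)
        show "(4 * sqrt 32 / sqrt (real n))\<^sup>2 \<le> \<epsilon>\<^sup>2"
          using n n0 assms by (simp add: power_divide power_mult_distrib field_simps)
      qed (use assms r in auto)
      finally show ?thesis .
    qed
    have "\<bar>G t \<omega> - G u \<omega>\<bar> \<le> (1 + 2 * \<epsilon>) * sqrt (h * l)"
      if \<omega>: "\<omega> \<in> space M - N" and cont: "continuous_on {0..} (\<lambda>t. G t \<omega>)" and t: "t \<in> {u..u + h}" for \<omega> t
    proof -
      have "\<exists>k\<le>n. \<bar>G t \<omega> - G (u + real k * w) \<omega>\<bar> \<le> \<epsilon> * r"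
      proof (rule dyadic_chaining[OF cont u w(1)])
        show "u \<le> t" "t \<le> u + real n * w" using t w by auto
        fix p k assume "k \<le> n * 2 ^ p"
        then have "\<omega> \<notin> D p k" using \<omega> unfolding N_def DD_def by blast
        then show "\<bar>G (u + real (2 * k + 1) * (w / 2 ^ Suc p)) \<omega> -
            G (u + real (2 * k) * (w / 2 ^ Suc p)) \<omega>\<bar> \<le> c p"
          using \<omega> unfolding D_def by auto
      qed (rule sumc)
      then obtain k where k: "k \<le> n" "\<bar>G t \<omega> - G (u + real k * w) \<omega>\<bar> \<le> \<epsilon> * r" by blast
      have "\<bar>G (u + real k * w) \<omega> - G u \<omega>\<bar> \<le> (1 + \<epsilon>) * r"
      proof (cases "k = 0")
        case True then show ?thesis using r assms by simp
      next
        case False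
        then have "\<omega> \<notin> A k" using \<omega> k unfolding N_def by auto
        then show ?thesis using \<omega> unfolding A_def by auto
      qed
      with k(2) show ?thesis unfolding r_def[symmetric] by (simp add: algebra_simps)
    qed
    with PN Nm show "\<exists>N\<in>sets M. prob N \<le> 5 * real n * C0 * exp (- (1 + \<epsilon>) * l) \<and>
        (\<forall>\<omega>\<in>space M - N. continuous_on {0..} (\<lambda>t. G t \<omega>) \<longrightarrow>
          (\<forall>t\<in>{u..u + h}. \<bar>G t \<omega> - G u \<omega>\<bar> \<le> (1 + 2 * \<epsilon>) * sqrt (h * l)))"
      by blast
  qed
  qed
qed

end

section \<open>Processes with sub-Gaussian increments: almost sure moduli\<close>

text \<open>
  A form of the Borel-Cantelli lemma in which \<open>P j\<close> need not define a measurable event.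
\<close>

lemma (in prob_space) borel_cantelli_eventually:
  assumes "summable b"
    and "\<forall>\<^sub>F j in sequentially. \<exists>N\<in>sets M. prob N \<le> b j \<and> (\<forall>\<omega>\<in>space M - N. P j \<omega>)"
  shows "AE \<omega> in M. \<forall>\<^sub>F j in sequentially. P j \<omega>"
proof -
  from assms(2) obtain J where
    "\<forall>j\<ge>J. \<exists>N. N \<in> sets M \<and> prob N \<le> b j \<and> (\<forall>\<omega>\<in>space M - N. P j \<omega>)"
    unfolding eventually_sequentially by blast
  then obtain N where N: "\<And>j. j \<ge> J \<Longrightarrow> N j \<in> sets M \<and> prob (N j) \<le> b j \<and> (\<forall>\<omega>\<in>space M - N j. P j \<omega>)"
    by metis
  define N' where "N' j = (if J \<le> j then N j else {})" for j
  have "AE \<omega> in M. \<forall>\<^sub>F j in sequentially. \<omega> \<in> space M - N' j"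
  proof (rule borel_cantelli_AE1)
    show "N' j \<in> sets M" for j using N by (simp add: N'_def)
    show "emeasure M (N' j) < \<infinity>" for j by (simp add: emeasure_eq_measure)
    show "summable (\<lambda>j. prob (N' j))"
      by (rule summable_comparison_test'[OF assms(1), of J]) (use N in \<open>simp add: N'_def\<close>)
  qed
  then show ?thesis
  proof eventually_elim
    case (elim \<omega>)
    show ?case
      using elim eventually_ge_at_top[of J] by eventually_elim (use N in \<open>auto simp: N'_def\<close>)
  qed
qed

text \<open>
  Every small \<open>h > 0\<close> lies between consecutive terms of the geometric sequence \<open>exp (- (L * j))\<close>.
\<close>

lemma eventually_at_right_0_from_geometric:
  fixes L :: real
  assumes "0 < L"
    and "\<forall>\<^sub>F j in sequentially. \<forall>h. exp (- (L * real (Suc j))) \<le> h \<longrightarrow> h \<le> exp (- (L * real j)) \<longrightarrow> R h"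
  shows "\<forall>\<^sub>F h in at_right 0. R h"
proof -
  from assms(2) obtain J where J:
    "\<And>j h. j \<ge> J \<Longrightarrow> exp (- (L * real (Suc j))) \<le> h \<Longrightarrow> h \<le> exp (- (L * real j)) \<Longrightarrow> R h"
    unfolding eventually_sequentially by blast
  have "R h" if h: "0 < h" "h < exp (- (L * real J))" for h
  proof -
    define y where "y = - ln h / L"
    have "ln h < - (L * real J)" using h by (metis ln_exp ln_less_cancel_iff exp_gt_zero)
    then have yJ: "real J \<le> y" using assms(1) by (simp add: y_def field_simps)
    define j where "j = nat \<lfloor>y\<rfloor>"
    have j: "real j \<le> y" "y \<le> real (Suc j)" using yJ of_nat_0_le_iff[of J, where 'a = real] unfolding j_def of_nat_Suc by linarith+
    have "j \<ge> J" using yJ by (simp add: j_def le_nat_floor)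
    moreover have "h = exp (- (L * y))" using h assms(1) by (simp add: y_def)
    ultimately show ?thesis
      using j assms(1) by (intro J) auto
  qed
  then show ?thesis
    unfolding eventually_at_right_field by (intro exI[of _ "exp (- (L * real J))"]) auto
qed

context subgaussian_increments
begin

text \<open>
  Along \<open>h = c powr (- j)\<close>, the maximal inequality with \<open>l = ln (ln (1 / h))\<close> gives probabilities of
  order \<open>j powr (- (1 + \<epsilon>))\<close>, which are summable. Passing to all \<open>h\<close> costs a
  factor \<open>sqrt c\<close>, and the remaining factor \<open>sqrt c\<close> is spent on \<open>\<epsilon>\<close>.
\<close>

lemma law_of_iterated_logarithm:
  assumes "1 < c"
  shows "AE \<omega> in M. continuous_on {0..} (\<lambda>t. G t \<omega>) \<longrightarrow>
    (\<forall>\<^sub>F h in at_right 0. \<forall>t\<in>{0..h}. \<bar>G t \<omega> - G 0 \<omega>\<bar> \<le> c * sqrt (h * ln (ln (1 / h))))"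
proof -
  define L where "L = ln c"
  have L: "0 < L" "exp L = c" using assms by (auto simp: L_def)
  define \<epsilon> where "\<epsilon> = min 1 ((sqrt c - 1) / 2)"
  have \<epsilon>: "0 < \<epsilon>" "\<epsilon> \<le> 1" "1 + 2 * \<epsilon> \<le> sqrt c"
    using assms by (auto simp: \<epsilon>_def min_def field_simps)
  obtain C \<delta> where C: "0 < C" and \<delta>: "0 < \<delta>" and
    "\<forall>u h l. 0 \<le> u \<longrightarrow> 0 < h \<longrightarrow> h \<le> \<delta> \<longrightarrow> 1 \<le> l \<longrightarrow> h * l \<le> \<delta> \<longrightarrow>
      (\<exists>N\<in>sets M. prob N \<le> C * exp (- (1 + \<epsilon>) * l) \<and>
        (\<forall>\<omega>\<in>space M - N. continuous_on {0..} (\<lambda>t. G t \<omega>) \<longrightarrow>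
          (\<forall>t\<in>{u..u + h}. \<bar>G t \<omega> - G u \<omega>\<bar> \<le> (1 + 2 * \<epsilon>) * sqrt (h * l))))"
    by (rule maximal_inequality[OF \<epsilon>(1,2)], rule that)
  note max = this(3)[rule_format]
  define h where "h j = exp (- (L * real j))" for j
  define l where "l j = ln (L * real j)" for j
  have large: "\<forall>\<^sub>F j in sequentially. h j \<le> \<delta> \<and> 1 \<le> l j \<and> h j * l j \<le> \<delta>"
  proof -
    have "(\<lambda>j. real j * exp (- L) ^ j) \<longlonglongrightarrow> 0"
      using L by (intro powser_times_n_limit_0) auto
    then have "(\<lambda>j. L * (real j * exp (- L) ^ j)) \<longlonglongrightarrow> L * 0" by (intro tendsto_intros)
    then have "\<forall>\<^sub>F j in sequentially. L * (real j * exp (- L) ^ j) < \<delta>"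
      using \<delta> by (intro order_tendstoD) auto
    moreover have "\<forall>\<^sub>F j in sequentially. exp 1 / L \<le> real j"
      using filterlim_real_sequentially unfolding filterlim_at_top by blast
    ultimately show ?thesis
    proof eventually_elim
      case (elim j)
      then have e: "exp 1 \<le> L * real j" using L by (simp add: field_simps)
      have "(1 :: real) < exp 1" by simp
      with e have 1: "1 \<le> L * real j" by linarith
      have hj: "h j = exp (- L) ^ j" by (simp add: h_def mult.commute flip: exp_of_nat_mult)
      have hd: "h j * (L * real j) \<le> \<delta>" using elim(1) by (simp add: hj mult_ac)
      have "1 \<le> l j" unfolding l_def using e ln_mono[of "exp 1" "L * real j"] by simp
      moreover have "h j * 1 \<le> h j * (L * real j)" using 1 by (intro mult_left_mono) (auto simp: h_def)
      moreover have "h j * l j \<le> h j * (L * real j)"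
        unfolding l_def using 1 ln_le_minus_one[of "L * real j"] by (intro mult_left_mono) (auto simp: h_def)
      ultimately show ?case using hd by linarith
    qed
  qed
  define Q where "Q j \<omega> \<longleftrightarrow> (continuous_on {0..} (\<lambda>t. G t \<omega>) \<longrightarrow>
      (\<forall>t\<in>{0..h j}. \<bar>G t \<omega> - G 0 \<omega>\<bar> \<le> (1 + 2 * \<epsilon>) * sqrt (h j * l j)))" for j \<omega>
  have "AE \<omega> in M. \<forall>\<^sub>F j in sequentially. Q j \<omega>"
  proof (rule borel_cantelli_eventually)
    have "summable (\<lambda>j. real j powr (- (1 + \<epsilon>)))"
      using \<epsilon> by (simp add: summable_real_powr_iff)
    then show "summable (\<lambda>j. C * (L powr (- (1 + \<epsilon>)) * real j powr (- (1 + \<epsilon>))))"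
      by (intro summable_mult)
    show "\<forall>\<^sub>F j in sequentially. \<exists>N\<in>sets M.
        prob N \<le> C * (L powr (- (1 + \<epsilon>)) * real j powr (- (1 + \<epsilon>))) \<and> (\<forall>\<omega>\<in>space M - N. Q j \<omega>)"
      using large eventually_gt_at_top[of 0]
    proof eventually_elim
      case (elim j)
      have "exp (- (1 + \<epsilon>) * l j) = L powr (- (1 + \<epsilon>)) * real j powr (- (1 + \<epsilon>))"
        using L elim by (simp add: l_def powr_def ln_mult algebra_simps flip: exp_add)
      with max[of 0 "h j" "l j"] elim show ?case
        unfolding Q_def by (simp add: h_def)
    qed
  qed
  then show ?thesis
  proof eventually_elim
    case (elim \<omega>)
    show ?case
    proof
      assume cont: "continuous_on {0..} (\<lambda>t. G t \<omega>)"
      show "\<forall>\<^sub>F x in at_right 0. \<forall>t\<in>{0..x}. \<bar>G t \<omega> - G 0 \<omega>\<bar> \<le> c * sqrt (x * ln (ln (1 / x)))"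
      proof (rule eventually_at_right_0_from_geometric[OF L(1)])
        show "\<forall>\<^sub>F j in sequentially. \<forall>x. exp (- (L * real (Suc j))) \<le> x \<longrightarrow> x \<le> exp (- (L * real j)) \<longrightarrow>
          (\<forall>t\<in>{0..x}. \<bar>G t \<omega> - G 0 \<omega>\<bar> \<le> c * sqrt (x * ln (ln (1 / x))))"
          using elim large eventually_gt_at_top[of 0]
        proof eventually_elim
          case (elim j)
          show ?case
          proof (intro allI impI ballI)
            fix x t assume x: "exp (- (L * real (Suc j))) \<le> x" "x \<le> exp (- (L * real j))" and t: "t \<in> {0..x}"
            have x0: "0 < x" using x(1) by (rule less_le_trans[OF exp_gt_zero])
            have "h j = c * exp (- (L * real (Suc j)))"
              by (simp add: h_def L(2)[symmetric] algebra_simps flip: exp_add)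
            then have hx: "h j \<le> c * x" using x(1) assms by (simp add: mult_left_mono)
            have Lj: "0 < L * real j" using L elim by simp
            have "ln x \<le> - (L * real j)" using x(2) x0 ln_mono[of x "exp (- (L * real j))"] by simp
            then have lx: "l j \<le> ln (ln (1 / x))"
              unfolding l_def using Lj x0 by (intro ln_mono) (auto simp: ln_div)
            have "\<bar>G t \<omega> - G 0 \<omega>\<bar> \<le> (1 + 2 * \<epsilon>) * sqrt (h j * l j)"
              using elim(1) cont t x(2) unfolding Q_def by (auto simp: h_def)
            also have "\<dots> \<le> sqrt c * sqrt ((c * x) * ln (ln (1 / x)))"
              using \<epsilon> hx lx elim assms x0 by (intro mult_mono real_sqrt_le_mono) (auto simp: h_def)
            also have "\<dots> = c * sqrt (x * ln (ln (1 / x)))"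
              using assms by (simp add: real_sqrt_mult flip: mult.assoc)
            finally show "\<bar>G t \<omega> - G 0 \<omega>\<bar> \<le> c * sqrt (x * ln (ln (1 / x)))" .
          qed
        qed
      qed
    qed
  qed
qed

text \<open>
  Along \<open>h = c powr (- j)\<close>, the maximal inequality with \<open>l = ln (1 / h)\<close> gives probabilities of order
  \<open>h powr (1 + \<epsilon>)\<close>, and there are about \<open>n / h\<close> base points \<open>u\<close> at distance \<open>h / n\<close>. If \<open>s \<le> t \<le> s + h\<close>
  and \<open>u\<close> is the last base point before \<open>s\<close>, then \<open>t\<close> is within \<open>(1 + 1 / n) * h\<close> of \<open>u\<close>, and
  comparing \<open>s\<close> with \<open>u\<close> costs only \<open>sqrt (h / n)\<close>. So the maximal inequality, which has a fixed base
  point, is enough.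
\<close>

lemma levy_modulus:
  assumes "1 < c"
  shows "AE \<omega> in M. continuous_on {0..} (\<lambda>t. G t \<omega>) \<longrightarrow>
    (\<forall>\<^sub>F h in at_right 0. \<forall>s\<in>{0..1}. \<forall>t\<in>{0..1}. \<bar>s - t\<bar> \<le> h \<longrightarrow>
      \<bar>G s \<omega> - G t \<omega>\<bar> \<le> c * sqrt (h * ln (1 / h)))"
proof -
  define L where "L = ln c"
  have L: "0 < L" "exp L = c" using assms by (auto simp: L_def)
  \<comment> \<open>Half of the exponent of \<open>c\<close> is spent on passing from the geometric sequence to all \<open>h\<close>, and
    a quarter each on \<open>\<epsilon>\<close> and on \<open>n\<close>.\<close>
  define q where "q = sqrt (sqrt c)"
  have q: "1 < q" "q * q = sqrt c" using assms by (auto simp: q_def)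
  define \<epsilon> where "\<epsilon> = min 1 ((q - 1) / 2)"
  have \<epsilon>: "0 < \<epsilon>" "\<epsilon> \<le> 1" "1 + 2 * \<epsilon> \<le> q"
    using q by (auto simp: \<epsilon>_def min_def field_simps)
  obtain C \<delta> where C: "0 < C" and \<delta>: "0 < \<delta>" and
    "\<forall>u h l. 0 \<le> u \<longrightarrow> 0 < h \<longrightarrow> h \<le> \<delta> \<longrightarrow> 1 \<le> l \<longrightarrow> h * l \<le> \<delta> \<longrightarrow>
      (\<exists>N\<in>sets M. prob N \<le> C * exp (- (1 + \<epsilon>) * l) \<and>
        (\<forall>\<omega>\<in>space M - N. continuous_on {0..} (\<lambda>t. G t \<omega>) \<longrightarrow>
          (\<forall>t\<in>{u..u + h}. \<bar>G t \<omega> - G u \<omega>\<bar> \<le> (1 + 2 * \<epsilon>) * sqrt (h * l))))"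
    by (rule maximal_inequality[OF \<epsilon>(1,2)], rule that)
  note max = this(3)[rule_format]
  obtain n :: nat where n: "0 < n" "sqrt (1 + 1 / real n) + sqrt (1 / real n) < q"
  proof -
    have "(\<lambda>n. sqrt (1 + 1 / real n) + sqrt (1 / real n)) \<longlonglongrightarrow> sqrt (1 + 0) + sqrt 0"
      by (intro tendsto_intros lim_1_over_n)
    then have "\<forall>\<^sub>F n in sequentially. sqrt (1 + 1 / real n) + sqrt (1 / real n) < q"
      using q by (intro order_tendstoD) auto
    then have "\<forall>\<^sub>F n in sequentially. 0 < n \<and> sqrt (1 + 1 / real n) + sqrt (1 / real n) < q"
      using eventually_gt_at_top[of 0] by eventually_elim simp
    then show ?thesis using that unfolding eventually_sequentially by blast
  qed
  define h where "h j = exp (- (L * real j))" for j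
  define l where "l j = L * real j" for j
  define m where "m j = nat \<lfloor>real n / h j\<rfloor>" for j
  define u where "u j i = real i * (h j / real n)" for j i
  define h1 where "h1 j = (1 + 1 / real n) * h j" for j
  define h2 where "h2 j = (1 / real n) * h j" for j
  have pos: "0 < h j" "0 < h1 j" "0 < h2 j" "h2 j \<le> h1 j" "h j \<le> 1" for j
    using n L by (auto simp: h_def h1_def h2_def add_pos_pos field_simps)
  have large: "\<forall>\<^sub>F j in sequentially. h1 j \<le> \<delta> \<and> 1 \<le> l j \<and> h1 j * l j \<le> \<delta>"
  proof -
    have "(\<lambda>j. real j * exp (- L) ^ j) \<longlonglongrightarrow> 0"
      using L by (intro powser_times_n_limit_0) auto
    then have "(\<lambda>j. (1 + 1 / real n) * L * (real j * exp (- L) ^ j)) \<longlonglongrightarrow> (1 + 1 / real n) * L * 0"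
      by (intro tendsto_intros)
    then have "\<forall>\<^sub>F j in sequentially. (1 + 1 / real n) * L * (real j * exp (- L) ^ j) < \<delta>"
      using \<delta> by (intro order_tendstoD) auto
    moreover have "\<forall>\<^sub>F j in sequentially. 1 / L \<le> real j"
      using filterlim_real_sequentially unfolding filterlim_at_top by blast
    ultimately show ?thesis
    proof eventually_elim
      case (elim j)
      then have 1: "1 \<le> l j" using L by (simp add: l_def field_simps)
      have hj: "h j = exp (- L) ^ j" by (simp add: h_def mult.commute flip: exp_of_nat_mult)
      have "h1 j * l j \<le> \<delta>" using elim(1) by (simp add: hj h1_def l_def mult_ac)
      moreover have "h1 j * 1 \<le> h1 j * l j" using 1 pos(2)[of j] by (intro mult_left_mono) auto
      ultimately show ?case using 1 by simp
    qed
  qed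
  define Q where "Q j \<omega> \<longleftrightarrow> (continuous_on {0..} (\<lambda>t. G t \<omega>) \<longrightarrow> (\<forall>i\<le>m j.
      (\<forall>t\<in>{u j i..u j i + h1 j}. \<bar>G t \<omega> - G (u j i) \<omega>\<bar> \<le> (1 + 2 * \<epsilon>) * sqrt (h1 j * l j)) \<and>
      (\<forall>t\<in>{u j i..u j i + h2 j}. \<bar>G t \<omega> - G (u j i) \<omega>\<bar> \<le> (1 + 2 * \<epsilon>) * sqrt (h2 j * l j))))"
    for j \<omega>
  have "AE \<omega> in M. \<forall>\<^sub>F j in sequentially. Q j \<omega>"
  proof (rule borel_cantelli_eventually)
    have "exp (- (\<epsilon> * L)) < 1" using \<epsilon> L by simp
    then show "summable (\<lambda>j. (4 * real n * C) * exp (- (\<epsilon> * L)) ^ j)"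
      by (intro summable_mult summable_geometric) auto
    show "\<forall>\<^sub>F j in sequentially. \<exists>N\<in>sets M.
        prob N \<le> (4 * real n * C) * exp (- (\<epsilon> * L)) ^ j \<and> (\<forall>\<omega>\<in>space M - N. Q j \<omega>)"
      using large
    proof eventually_elim
      case (elim j)
      define b where "b = C * exp (- (1 + \<epsilon>) * l j)"
      have "\<exists>N\<in>sets M. prob N \<le> b \<and>
        (\<forall>\<omega>\<in>space M - N. continuous_on {0..} (\<lambda>t. G t \<omega>) \<longrightarrow>
          (\<forall>t\<in>{u j i..u j i + H}. \<bar>G t \<omega> - G (u j i) \<omega>\<bar> \<le> (1 + 2 * \<epsilon>) * sqrt (H * l j)))"
        if H: "0 < H" "H \<le> h1 j" for i H
      proof -
        have "H * l j \<le> h1 j * l j" using H elim by (intro mult_right_mono) auto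
        also have "\<dots> \<le> \<delta>" using elim by simp
        finally show ?thesis
          unfolding b_def using H elim pos[of j] n by (intro max) (auto simp: u_def)
      qed
      from this[OF pos(2) order.refl] this[OF pos(3,4)]
      obtain N1 N2 where N1: "\<And>i. N1 i \<in> sets M" "\<And>i. prob (N1 i) \<le> b"
          "\<And>i \<omega> t. \<lbrakk>\<omega> \<in> space M - N1 i; continuous_on {0..} (\<lambda>t. G t \<omega>); t \<in> {u j i..u j i + h1 j}\<rbrakk> \<Longrightarrow>
            \<bar>G t \<omega> - G (u j i) \<omega>\<bar> \<le> (1 + 2 * \<epsilon>) * sqrt (h1 j * l j)"
        and N2: "\<And>i. N2 i \<in> sets M" "\<And>i. prob (N2 i) \<le> b"
          "\<And>i \<omega> t. \<lbrakk>\<omega> \<in> space M - N2 i; continuous_on {0..} (\<lambda>t. G t \<omega>); t \<in> {u j i..u j i + h2 j}\<rbrakk> \<Longrightarrow>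
            \<bar>G t \<omega> - G (u j i) \<omega>\<bar> \<le> (1 + 2 * \<epsilon>) * sqrt (h2 j * l j)"
        by metis
      define N where "N = (\<Union>i\<in>{..m j}. N1 i \<union> N2 i)"
      have "prob N \<le> (\<Sum>i\<in>{..m j}. prob (N1 i \<union> N2 i))"
        unfolding N_def using N1 N2 by (intro finite_measure_subadditive_finite) auto
      also have "\<dots> \<le> real (card {..m j}) * (2 * b)"
      proof (rule sum_bounded_above)
        show "prob (N1 i \<union> N2 i) \<le> 2 * b" for i
          using measure_Un_le[OF N1(1)[of i] N2(1)[of i]] N1(2)[of i] N2(2)[of i] by linarith
      qed
      also have "\<dots> \<le> (2 * real n / h j) * (2 * b)"
      proof (rule mult_right_mono)
        have "1 \<le> real n / h j" using n pos(1,5)[of j] by (simp add: field_simps)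
        moreover have "real (m j) \<le> real n / h j" using pos(1)[of j] by (simp add: m_def)
        ultimately have "real (m j) + 1 \<le> 2 * (real n / h j)" by linarith
        then show "real (card {..m j}) \<le> 2 * real n / h j" by (simp add: add.commute)
      qed (use C in \<open>simp add: b_def\<close>)
      also have "\<dots> = (4 * real n * C) * (exp (- (1 + \<epsilon>) * l j) / h j)"
        by (simp add: b_def)
      also have "exp (- (1 + \<epsilon>) * l j) / h j = exp (- (\<epsilon> * L)) ^ j"
        by (simp add: h_def l_def algebra_simps flip: exp_diff exp_of_nat_mult)
      finally have PN: "prob N \<le> (4 * real n * C) * exp (- (\<epsilon> * L)) ^ j" .
      have "N \<in> sets M" unfolding N_def using N1 N2 by auto
      moreover have "Q j \<omega>" if "\<omega> \<in> space M - N" for \<omega>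
        unfolding Q_def using that by (intro impI allI conjI ballI N1(3) N2(3)) (auto simp: N_def)
      ultimately show ?case using PN by blast
    qed
  qed
  then show ?thesis
  proof eventually_elim
    case (elim \<omega>)
    show ?case
    proof
      assume cont: "continuous_on {0..} (\<lambda>t. G t \<omega>)"
      show "\<forall>\<^sub>F x in at_right 0. \<forall>s\<in>{0..1}. \<forall>t\<in>{0..1}. \<bar>s - t\<bar> \<le> x \<longrightarrow>
        \<bar>G s \<omega> - G t \<omega>\<bar> \<le> c * sqrt (x * ln (1 / x))"
      proof (rule eventually_at_right_0_from_geometric[OF L(1)])
        show "\<forall>\<^sub>F j in sequentially. \<forall>x. exp (- (L * real (Suc j))) \<le> x \<longrightarrow> x \<le> exp (- (L * real j)) \<longrightarrow>
          (\<forall>s\<in>{0..1}. \<forall>t\<in>{0..1}. \<bar>s - t\<bar> \<le> x \<longrightarrow> \<bar>G s \<omega> - G t \<omega>\<bar> \<le> c * sqrt (x * ln (1 / x)))"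
          using elim large
        proof eventually_elim
          case (elim j)
          have ordered: "\<bar>G s \<omega> - G t \<omega>\<bar> \<le> sqrt c * sqrt (h j * l j)"
            if st: "0 \<le> s" "s \<le> t" "s \<le> 1" "t - s \<le> h j" for s t
          proof -
            define i where "i = nat \<lfloor>s * real n / h j\<rfloor>"
            have y0: "0 \<le> s * real n / h j" using st pos(1)[of j] by simp
            have i: "real i \<le> s * real n / h j" "s * real n / h j \<le> real i + 1"
              using y0 unfolding i_def by linarith+
            have "s * real n / h j \<le> real n / h j"
              using st pos(1)[of j] n by (intro divide_right_mono) auto
            then have im: "i \<le> m j" unfolding i_def m_def by (intro nat_mono floor_mono)
            have us: "u j i \<le> s" "s \<le> u j i + h2 j"
              using i pos(1)[of j] n by (auto simp: u_def h2_def field_simps)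
            have "\<bar>G s \<omega> - G (u j i) \<omega>\<bar> \<le> (1 + 2 * \<epsilon>) * sqrt (h2 j * l j)"
              using elim(1) cont im us unfolding Q_def by auto
            moreover have "t \<le> u j i + h1 j"
              using us st by (simp add: h1_def h2_def algebra_simps)
            then have "\<bar>G t \<omega> - G (u j i) \<omega>\<bar> \<le> (1 + 2 * \<epsilon>) * sqrt (h1 j * l j)"
              using elim(1) cont im us st unfolding Q_def by auto
            ultimately have "\<bar>G s \<omega> - G t \<omega>\<bar> \<le> (1 + 2 * \<epsilon>) * (sqrt (h1 j * l j) + sqrt (h2 j * l j))"
              unfolding distrib_left by linarith
            also have "\<dots> = (1 + 2 * \<epsilon>) * (sqrt (1 + 1 / real n) + sqrt (1 / real n)) * sqrt (h j * l j)"
              by (simp only: h1_def h2_def mult.assoc real_sqrt_mult) (simp add: algebra_simps)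
            also have "\<dots> \<le> (q * q) * sqrt (h j * l j)"
              using \<epsilon> n q elim pos(1)[of j] by (intro mult_right_mono mult_mono) auto
            finally show ?thesis by (simp add: q)
          qed
          show ?case
          proof (intro allI impI ballI)
            fix x s t :: real
            assume x: "exp (- (L * real (Suc j))) \<le> x" "x \<le> exp (- (L * real j))"
              and st: "s \<in> {0..1}" "t \<in> {0..1}" "\<bar>s - t\<bar> \<le> x"
            have x0: "0 < x" using x(1) by (rule less_le_trans[OF exp_gt_zero])
            have "h j = c * exp (- (L * real (Suc j)))"
              by (simp add: h_def L(2)[symmetric] algebra_simps flip: exp_add)
            then have hx: "h j \<le> c * x" using x(1) assms by (simp add: mult_left_mono)
            have "ln x \<le> - (L * real j)" using x(2) x0 ln_mono[of x "exp (- (L * real j))"] by simp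
            then have lx: "l j \<le> ln (1 / x)" unfolding l_def using x0 by (simp add: ln_div)
            have "\<bar>G s \<omega> - G t \<omega>\<bar> \<le> sqrt c * sqrt (h j * l j)"
            proof (cases "s \<le> t")
              case True
              then show ?thesis using st x by (intro ordered) (auto simp: h_def)
            next
              case False
              then have "\<bar>G t \<omega> - G s \<omega>\<bar> \<le> sqrt c * sqrt (h j * l j)"
                using st x by (intro ordered) (auto simp: h_def)
              then show ?thesis by (simp add: abs_minus_commute)
            qed
            also have "\<dots> \<le> sqrt c * sqrt ((c * x) * ln (1 / x))"
              using hx lx elim assms x0 pos(1)[of j]
              by (intro mult_left_mono mult_mono real_sqrt_le_mono) auto
            also have "\<dots> = c * sqrt (x * ln (1 / x))"
              using assms by (simp add: real_sqrt_mult flip: mult.assoc)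
            finally show "\<bar>G s \<omega> - G t \<omega>\<bar> \<le> c * sqrt (x * ln (1 / x))" .
          qed
        qed
      qed
    qed
  qed
qed

end

section \<open>Truncation and the moduli of the permanental process\<close>

text \<open>
  Time is stopped outside \<open>{0..T}\<close>, so that the process is indexed by the whole half-line and grid points
  may lie beyond \<open>T\<close>. Truncation at \<open>m\<close> turns the tail bound on \<open>X t \<le> m\<close> into an
  unconditional one: if two values of the truncated process differ, the smaller one is below \<open>m\<close>.
\<close>

definition normalized_truncation ::
  "real \<Rightarrow> real \<Rightarrow> real \<Rightarrow> (real \<Rightarrow> 'a \<Rightarrow> real) \<Rightarrow> real \<Rightarrow> 'a \<Rightarrow> real" where
  "normalized_truncation lam m T X t \<omega> =
     min (X (max 0 (min t T)) \<omega>) m / (2 * sqrt (2 * lam) * sqrt m)"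

lemma subgaussian_normalized_truncation:
  assumes "0 < lam" "0 < \<alpha>" and perm: "permanental_process \<alpha> M {0..1} X (u_hat lam f)"
    and f0: "\<And>t. t \<in> {0..1} \<Longrightarrow> 0 \<le> f t"
    and lip: "L-lipschitz_on {0..1} f"
    and "0 < m" "0 < T" "T \<le> 1"
  shows "subgaussian_increments M (normalized_truncation lam m T X)"
proof -
  define \<pi> where "\<pi> t = max 0 (min t T)" for t :: real
  have \<pi>: "\<pi> t \<in> {0..1}" for t using assms by (auto simp: \<pi>_def)
  interpret prob_space M using permanental_pair(1)[OF perm \<pi>[of 0] \<pi>[of 0]] .
  have Xm [measurable]: "X (\<pi> t) \<in> borel_measurable M" for t
    using permanental_pair(2)[OF perm \<pi> \<pi>] .
  define G where "G = normalized_truncation lam m T X"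
  define c where "c = 2 * sqrt (2 * lam) * sqrt m"
  have c: "0 < c" using assms by (simp add: c_def)
  have G_eq: "G t \<omega> = min (X (\<pi> t) \<omega>) m / c" for t \<omega>
    by (simp add: G_def normalized_truncation_def \<pi>_def c_def)
  have Gm [measurable]: "G t \<in> borel_measurable M" for t
    unfolding G_eq[abs_def] by measurable
  have L: "0 \<le> L" using lip by (rule lipschitz_on_nonneg)
  have lip': "\<bar>f (\<pi> s) - f (\<pi> t)\<bar> \<le> L * \<bar>\<pi> s - \<pi> t\<bar>" for s t
    using lipschitz_onD[OF lip \<pi> \<pi>] by (simp add: dist_real_def)
  define K where "K = exp (2 * L * m * (1 + lam) / lam)"
  have "subgaussian_increments M G"
  proof (unfold_locales)
    show "G t \<in> borel_measurable M" for t by measurable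
    fix \<epsilon> :: real assume \<epsilon>: "0 < \<epsilon>" "\<epsilon> < 1"
    define \<delta> where "\<delta> = min 1 (min (\<epsilon> / (2 * (L + 1))) (\<epsilon> * sqrt m / (2 * sqrt (2 * lam))))"
    have \<delta>: "0 < \<delta>" using \<epsilon> L assms by (simp add: \<delta>_def add_nonneg_pos)
    have main: "prob {\<omega> \<in> space M. g \<le> \<bar>G s \<omega> - G t \<omega>\<bar>} \<le> 2 * K * exp (- (1 - \<epsilon>) * g\<^sup>2 / h)"
      if sth: "\<bar>s - t\<bar> \<le> h" "0 < h" "h \<le> \<delta>" and g: "0 < g" "g \<le> \<delta>" for s t h g
    proof (cases "\<pi> s = \<pi> t")
      case True
      then have "{\<omega> \<in> space M. g \<le> \<bar>G s \<omega> - G t \<omega>\<bar>} = {}" using g by (simp add: G_eq)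
      then show ?thesis by (simp only: measure_empty) (simp add: K_def)
    next
      case False
      define x where "x = sqrt (2 * lam) * g"
      have x: "0 < x" "x\<^sup>2 = 2 * lam * g\<^sup>2" using g assms by (auto simp: x_def power_mult_distrib)
      have cg: "c * g = 2 * sqrt m * x" by (simp add: c_def x_def)
      have "g \<le> \<epsilon> * sqrt m / (2 * sqrt (2 * lam))" using g by (simp add: \<delta>_def)
      then have \<beta>: "x / sqrt m \<le> \<epsilon> / 2" using assms by (simp add: x_def field_simps)
      with \<epsilon> have "x / sqrt m < 1" by linarith
      then have xm: "x < sqrt m" using \<open>0 < m\<close> by (simp add: divide_less_eq)
      have tail: "prob {\<omega> \<in> space M. X (\<pi> b) \<omega> \<le> m \<and> 2 * sqrt m * x \<le> X (\<pi> a) \<omega> - X (\<pi> b) \<omega>}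
          \<le> K * exp (- (1 - \<epsilon>) * g\<^sup>2 / h)"
        if ab: "\<pi> a \<noteq> \<pi> b" "\<bar>a - b\<bar> \<le> h" for a b
      proof -
        define h0 where "h0 = \<bar>\<pi> a - \<pi> b\<bar>"
        have h0: "0 < h0" using ab(1) by (simp add: h0_def)
        have h0h: "h0 \<le> h" using ab(2) unfolding h0_def \<pi>_def by linarith
        note h0 = h0 h0h
        have "h \<le> \<epsilon> / (2 * (L + 1))" using sth by (simp add: \<delta>_def)
        then have "2 * ((L + 1) * h) \<le> \<epsilon>" using L by (simp add: field_simps)
        moreover have "L * h0 \<le> (L + 1) * h" using L h0 by (intro mult_mono) auto
        ultimately have Lh0: "L * h0 \<le> \<epsilon> / 2" by linarith
        have h01: "h0 \<le> 1" using h0 sth by (simp add: \<delta>_def)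
        have "prob {\<omega> \<in> space M. X (\<pi> b) \<omega> \<le> m \<and> 2 * sqrt m * x \<le> X (\<pi> a) \<omega> - X (\<pi> b) \<omega>}
          \<le> K * exp (- (1 - x / sqrt m) * x\<^sup>2 / (2 * lam * h0 * (1 + L * h0)))"
          unfolding K_def h0_def
          by (rule permanental_increment_tail[OF \<open>0 < lam\<close> \<open>0 < \<alpha>\<close> perm \<pi> \<pi> f0[OF \<pi>] f0[OF \<pi>] lip' L])
             (use h0 h01 Lh0 \<epsilon> x(1) xm \<open>0 < m\<close> in \<open>auto simp: h0_def\<close>)
        also have "\<dots> \<le> K * exp (- (1 - \<epsilon>) * g\<^sup>2 / h)"
        proof -
          have L0: "0 \<le> L * h0" using L h0 by simp
          have "(1 - \<epsilon>) * (h0 * (1 + L * h0)) \<le> (1 - \<epsilon>) * (h * (1 + \<epsilon> / 2))"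
            using \<epsilon> h0 Lh0 L0 by (intro mult_left_mono mult_mono) auto
          also have "\<dots> = (1 - \<epsilon> / 2 - \<epsilon>\<^sup>2 / 2) * h" by (simp add: power2_eq_square field_simps)
          also have "\<dots> \<le> (1 - x / sqrt m) * h"
            using \<beta> h0 zero_le_power2[of \<epsilon>] by (intro mult_right_mono) linarith+
          finally have *: "(1 - \<epsilon>) * (h0 * (1 + L * h0)) \<le> (1 - x / sqrt m) * h" .
          have "(1 - \<epsilon>) / h \<le> (1 - x / sqrt m) / (h0 * (1 + L * h0))"
          proof -
            have "0 < h0 * (1 + L * h0)" using h0 L0 by (simp add: add_pos_nonneg)
            moreover from * have "(1 - \<epsilon>) * (h0 * (1 + L * h0)) / h \<le> 1 - x / sqrt m"
              using \<open>0 < h\<close> by (simp add: pos_divide_le_eq)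
            ultimately show ?thesis by (simp add: pos_le_divide_eq)
          qed
          then have "(1 - \<epsilon>) / h * g\<^sup>2 \<le> (1 - x / sqrt m) / (h0 * (1 + L * h0)) * g\<^sup>2"
            by (rule mult_right_mono) simp
          also have "\<dots> = (1 - x / sqrt m) * x\<^sup>2 / (2 * lam * h0 * (1 + L * h0))"
            unfolding x(2) using \<open>0 < lam\<close> by simp
          finally have "- (1 - x / sqrt m) * x\<^sup>2 / (2 * lam * h0 * (1 + L * h0)) \<le> - (1 - \<epsilon>) * g\<^sup>2 / h"
            by (simp only: mult_minus_left minus_divide_left[symmetric] neg_le_iff_le times_divide_eq_left)
          then show ?thesis by (simp add: K_def)
        qed
        finally show ?thesis .
      qed
      let ?E = "\<lambda>a b. {\<omega> \<in> space M. X (\<pi> b) \<omega> \<le> m \<and> 2 * sqrt m * x \<le> X (\<pi> a) \<omega> - X (\<pi> b) \<omega>}"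
      have y0: "0 < c * g" using c g by simp
      have "{\<omega> \<in> space M. g \<le> \<bar>G s \<omega> - G t \<omega>\<bar>} \<subseteq> ?E s t \<union> ?E t s"
      proof
        fix \<omega> assume "\<omega> \<in> {\<omega> \<in> space M. g \<le> \<bar>G s \<omega> - G t \<omega>\<bar>}"
        then have a: "\<omega> \<in> space M" "g \<le> \<bar>G s \<omega> - G t \<omega>\<bar>" by auto
        have "\<bar>G s \<omega> - G t \<omega>\<bar> = \<bar>min (X (\<pi> s) \<omega>) m - min (X (\<pi> t) \<omega>) m\<bar> / c"
          using c unfolding G_eq by (simp flip: diff_divide_distrib)
        then have "c * \<bar>G s \<omega> - G t \<omega>\<bar> = \<bar>min (X (\<pi> s) \<omega>) m - min (X (\<pi> t) \<omega>) m\<bar>"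
          using c by simp
        moreover have "c * g \<le> c * \<bar>G s \<omega> - G t \<omega>\<bar>" using a(2) c by (intro mult_left_mono) auto
        ultimately have "c * g \<le> \<bar>min (X (\<pi> s) \<omega>) m - min (X (\<pi> t) \<omega>) m\<bar>" by simp
        then have "(X (\<pi> t) \<omega> \<le> m \<and> c * g \<le> X (\<pi> s) \<omega> - X (\<pi> t) \<omega>) \<or>
            (X (\<pi> s) \<omega> \<le> m \<and> c * g \<le> X (\<pi> t) \<omega> - X (\<pi> s) \<omega>)"
          using y0 by (auto simp: min_def abs_if split: if_splits)
        then show "\<omega> \<in> ?E s t \<union> ?E t s" using a(1) by (simp add: cg)
      qed
      then have "prob {\<omega> \<in> space M. g \<le> \<bar>G s \<omega> - G t \<omega>\<bar>} \<le> prob (?E s t \<union> ?E t s)"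
        by (intro finite_measure_mono) measurable
      also have "\<dots> \<le> prob (?E s t) + prob (?E t s)"
        by (intro measure_Un_le) measurable
      also have "\<dots> \<le> 2 * K * exp (- (1 - \<epsilon>) * g\<^sup>2 / h)"
        using tail[of s t] tail[of t s] False sth(1) by (simp add: abs_minus_commute)
      finally show ?thesis .
    qed
    show "\<exists>C \<delta>. 0 < C \<and> 0 < \<delta> \<and>
      (\<forall>s t h g. 0 \<le> s \<longrightarrow> 0 \<le> t \<longrightarrow> \<bar>s - t\<bar> \<le> h \<longrightarrow> 0 < h \<longrightarrow> h \<le> \<delta> \<longrightarrow> 0 < g \<longrightarrow> g \<le> \<delta> \<longrightarrow>
        prob {\<omega> \<in> space M. g \<le> \<bar>G s \<omega> - G t \<omega>\<bar>} \<le> C * exp (- (1 - \<epsilon>) * g\<^sup>2 / h))"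
    proof (rule exI[of _ "2 * K"], rule exI[of _ \<delta>], intro conjI allI impI)
      show "0 < 2 * K" by (simp add: K_def)
      show "0 < \<delta>" by fact
    qed (rule main)
  qed
  then show ?thesis by (simp only: G_def)
qed

text \<open>
  Rational levels and the constants \<open>1 + 1 / Suc k\<close> give a single exceptional null set, so that the
  level may later be chosen depending on \<open>\<omega>\<close>.
\<close>

lemma moduli_of_normalized_truncations:
  assumes "0 < lam" "0 < \<alpha>" and perm: "permanental_process \<alpha> M {0..1} X (u_hat lam f)"
    and "\<And>t. t \<in> {0..1} \<Longrightarrow> 0 \<le> f t"
    and "L-lipschitz_on {0..1} f"
    and cont: "AE \<omega> in M. continuous_on {0..1} (\<lambda>t. X t \<omega>)"
    and T: "0 < T" "T \<le> 1"
  shows "AE \<omega> in M. \<forall>(r::rat) (k::nat). 0 < r \<longrightarrow>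
    (let G = (\<lambda>t. normalized_truncation lam (of_rat r) T X t \<omega>); c = 1 + 1 / real (Suc k)
     in (\<forall>\<^sub>F h in at_right 0. \<forall>t\<in>{0..h}. \<bar>G t - G 0\<bar> \<le> c * sqrt (h * ln (ln (1 / h)))) \<and>
        (\<forall>\<^sub>F h in at_right 0. \<forall>s\<in>{0..1}. \<forall>t\<in>{0..1}. \<bar>s - t\<bar> \<le> h \<longrightarrow>
           \<bar>G s - G t\<bar> \<le> c * sqrt (h * ln (1 / h))))"
  unfolding AE_all_countable
proof (intro allI)
  fix r :: rat and k :: nat
  show "AE \<omega> in M. 0 < r \<longrightarrow>
    (let G = (\<lambda>t. normalized_truncation lam (of_rat r) T X t \<omega>); c = 1 + 1 / real (Suc k)
     in (\<forall>\<^sub>F h in at_right 0. \<forall>t\<in>{0..h}. \<bar>G t - G 0\<bar> \<le> c * sqrt (h * ln (ln (1 / h)))) \<and>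
        (\<forall>\<^sub>F h in at_right 0. \<forall>s\<in>{0..1}. \<forall>t\<in>{0..1}. \<bar>s - t\<bar> \<le> h \<longrightarrow>
           \<bar>G s - G t\<bar> \<le> c * sqrt (h * ln (1 / h))))"
  proof (cases "0 < r")
    case True
    define m :: real where "m = of_rat r"
    have m: "0 < m" using True by (simp add: m_def)
    interpret subgaussian_increments M "normalized_truncation lam m T X"
      by (rule subgaussian_normalized_truncation) (use assms m in auto)
    have c: "1 < 1 + 1 / real (Suc k)" by simp
    show ?thesis
      using cont law_of_iterated_logarithm[OF c] levy_modulus[OF c]
    proof eventually_elim
      case (elim \<omega>)
      have "continuous_on {0..} (\<lambda>t. normalized_truncation lam m T X t \<omega>)"
        unfolding normalized_truncation_def
        by (intro continuous_intros continuous_on_compose2[OF elim(1)]) (use T m assms(1) in auto)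
      then show ?case using elim unfolding Let_def m_def by blast
    qed
  qed simp
qed

lemma ereal_le_of_rational_approximations:
  fixes y :: ereal and C x :: real
  assumes "\<And>(r::rat) (k::nat). x < of_rat r \<Longrightarrow> y \<le> ereal (C * sqrt (of_rat r) * (1 + 1 / real (Suc k)))"
  shows "y \<le> ereal (C * sqrt x)"
proof -
  have "\<exists>r::rat. x < of_rat r \<and> of_rat r < x + 1 / real (Suc k)" for k
    by (rule of_rat_dense) simp
  then obtain r :: "nat \<Rightarrow> rat" where r: "\<And>k. x < of_rat (r k)" "\<And>k. of_rat (r k) < x + 1 / real (Suc k)"
    by metis
  have lim0: "(\<lambda>k. 1 / real (Suc k)) \<longlonglongrightarrow> 0"
    by (rule LIMSEQ_Suc[OF lim_1_over_n])
  have "(\<lambda>k. real_of_rat (r k)) \<longlonglongrightarrow> x"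
  proof (rule tendsto_sandwich)
    show "\<forall>\<^sub>F k in sequentially. x \<le> of_rat (r k)"
      by (intro always_eventually allI less_imp_le r)
    show "\<forall>\<^sub>F k in sequentially. of_rat (r k) \<le> x + 1 / real (Suc k)"
      by (intro always_eventually allI less_imp_le r)
    show "(\<lambda>k. x + 1 / real (Suc k)) \<longlonglongrightarrow> x" using tendsto_add[OF tendsto_const lim0, of x] by simp
  qed simp
  then have "(\<lambda>k. C * sqrt (of_rat (r k)) * (1 + 1 / real (Suc k))) \<longlonglongrightarrow> C * sqrt x * (1 + 0)"
    using lim0 by (intro tendsto_intros)
  then have "(\<lambda>k. ereal (C * sqrt (of_rat (r k)) * (1 + 1 / real (Suc k)))) \<longlonglongrightarrow> ereal (C * sqrt x)"
    by simp
  then show ?thesis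
    by (rule LIMSEQ_le_const) (use assms r in blast)
qed

lemma C2_imp_lipschitz_on_interval:
  assumes "C2 f"
  obtains L where "L-lipschitz_on {a..b} f"
proof -
  have "continuous_on {a..b} (deriv f)"
    using assms unfolding C2_def
    by (meson continuous_at_imp_continuous_on differentiable_imp_continuous_within)
  then have "bounded (deriv f ` {a..b})"
    by (intro compact_imp_bounded compact_continuous_image) auto
  then obtain L where L: "0 < L" "\<forall>y\<in>deriv f ` {a..b}. norm y \<le> L"
    unfolding bounded_pos by blast
  have "L-lipschitz_on {a..b} f"
  proof (rule lipschitz_onI)
    show "dist (f s) (f t) \<le> L * dist s t" if "s \<in> {a..b}" "t \<in> {a..b}" for s t
      unfolding dist_norm
    proof (rule field_differentiable_bound[of "{a..b}" f "deriv f" L])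
      show "(f has_field_derivative deriv f x) (at x within {a..b})" for x
        using assms unfolding C2_def
        by (simp add: DERIV_deriv_iff_real_differentiable has_field_derivative_at_within)
    qed (use L that in auto)
  qed (use L in simp)
  then show thesis by (rule that)
qed

theorem theorem1p10:
  fixes lam \<alpha> :: real
    and f :: "real \<Rightarrow> real"
    and P :: "real \<Rightarrow> 'b measure" and Z :: "real \<Rightarrow> 'b \<Rightarrow> real option"
    and M :: "'a measure" and X :: "real \<Rightarrow> 'a \<Rightarrow> real"
  assumes "lam > 0" and "\<alpha> > 0"
    and "exp_killed_brownian_motion (lam\<^sup>2 / 2) P Z"
    and "C2 f" and "excessive P Z f"
    and "permanental_process \<alpha> M {0..1} X (u_hat lam f)"
    and "AE \<omega> in M. continuous_on {0..1} (\<lambda>t. X t \<omega>)"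
  shows "(AE \<omega> in M.
            Limsup (at_right 0)
              (\<lambda>h. SUP t\<in>{0..h}. ereal (\<bar>X t \<omega> - X 0 \<omega>\<bar> / sqrt (h * ln (ln (1 / h)))))
            \<le> ereal (2 * sqrt (2 * lam) * sqrt (X 0 \<omega>)))
       \<and> (\<forall>T. 0 < T \<and> T \<le> 1 \<longrightarrow>
           (AE \<omega> in M.
              Limsup (at_right 0)
                (\<lambda>h. SUP (s, t)\<in>{(s, t). s \<in> {0..T} \<and> t \<in> {0..T} \<and> \<bar>s - t\<bar> \<le> h}.
                       ereal (\<bar>X s \<omega> - X t \<omega>\<bar> / sqrt (h * ln (1 / h))))
              \<le> ereal (2 * sqrt (2 * lam) * sqrt (SUP t\<in>{0..T}. X t \<omega>))))"
proof -
  have f0: "0 \<le> f t" for t using assms(5) by (simp add: excessive_def)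
  obtain L where lip: "L-lipschitz_on {0..1} f"
    using \<open>C2 f\<close> by (rule C2_imp_lipschitz_on_interval)
  note moduli = moduli_of_normalized_truncations[OF assms(1,2,6) f0 lip assms(7)]
  have X0: "AE \<omega> in M. 0 \<le> X 0 \<omega>"
    using permanental_pair(3)[OF assms(6), of 0 0] by simp
  have one: "0 < (1 :: real)" "(1 :: real) \<le> 1" by simp_all
  let ?C = "2 * sqrt (2 * lam)"
  have C0: "0 < ?C" using assms(1) by simp
  have untruncate: "\<bar>X s \<omega> - X t \<omega>\<bar> = ?C * sqrt m *
      \<bar>normalized_truncation lam m T X s \<omega> - normalized_truncation lam m T X t \<omega>\<bar>"
    if "0 < m" "s \<in> {0..T}" "t \<in> {0..T}" "X s \<omega> \<le> m" "X t \<omega> \<le> m" for m T s t \<omega>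
    using that C0 by (simp add: normalized_truncation_def abs_mult flip: diff_divide_distrib)
  have quotient_le: "ereal (\<bar>X s \<omega> - X t \<omega>\<bar> / d) \<le> ereal (?C * sqrt m * c)"
    if "0 < m" "s \<in> {0..T}" "t \<in> {0..T}" "X s \<omega> \<le> m" "X t \<omega> \<le> m" "0 < d"
      "\<bar>normalized_truncation lam m T X s \<omega> - normalized_truncation lam m T X t \<omega>\<bar> \<le> c * d"
    for m T s t \<omega> c d
  proof -
    have "\<bar>X s \<omega> - X t \<omega>\<bar> \<le> ?C * sqrt m * (c * d)"
      unfolding untruncate[OF that(1-5)] using C0 that by (intro mult_left_mono) auto
    then show ?thesis using that(6) by (simp add: pos_divide_le_eq mult_ac)
  qed
  have "AE \<omega> in M. Limsup (at_right 0)
      (\<lambda>h. SUP t\<in>{0..h}. ereal (\<bar>X t \<omega> - X 0 \<omega>\<bar> / sqrt (h * ln (ln (1 / h)))))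
      \<le> ereal (?C * sqrt (X 0 \<omega>))"
    using moduli[OF one] X0 assms(7)
  proof eventually_elim
    case (elim \<omega>)
    show ?case
    proof (rule ereal_le_of_rational_approximations)
      fix r :: rat and k :: nat assume r: "X 0 \<omega> < of_rat r"
      define m :: real where "m = of_rat r"
      define c where "c = 1 + 1 / real (Suc k)"
      let ?G = "\<lambda>t. normalized_truncation lam m 1 X t \<omega>"
      have "X 0 \<omega> < m" using r by (simp add: m_def)
      moreover from this have "0 < m" using elim(2) by linarith
      ultimately have m: "X 0 \<omega> < m" "0 < m" .
      then have "0 < r" by (simp add: m_def)
      then have mod: "\<forall>\<^sub>F h in at_right 0. \<forall>t\<in>{0..h}. \<bar>?G t - ?G 0\<bar> \<le> c * sqrt (h * ln (ln (1 / h)))"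
        using elim(1) unfolding Let_def m_def c_def by auto
      have "((\<lambda>t. X t \<omega>) \<longlongrightarrow> X 0 \<omega>) (at 0 within {0..1})"
        using elim(3) by (simp add: continuous_on)
      then have "\<forall>\<^sub>F t in at 0 within {0..1}. X t \<omega> < m"
        using m by (intro order_tendstoD)
      then obtain d where d: "0 < d" "\<And>t. t \<in> {0..1} \<Longrightarrow> t \<noteq> 0 \<Longrightarrow> \<bar>t\<bar> < d \<Longrightarrow> X t \<omega> < m"
        unfolding eventually_at by (auto simp: dist_real_def)
      have "\<forall>\<^sub>F h in at_right (0::real). h < min d (exp (- exp 1))"
        using d(1) by (intro eventually_at_rightI[of 0 "min d (exp (- exp 1))"]) auto
      then have small: "\<forall>\<^sub>F h in at_right 0. 0 < h \<and> h < d \<and> h < exp (- exp 1)"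
        using eventually_at_right_less[of "0::real"] by eventually_elim auto
      show "Limsup (at_right 0)
          (\<lambda>h. SUP t\<in>{0..h}. ereal (\<bar>X t \<omega> - X 0 \<omega>\<bar> / sqrt (h * ln (ln (1 / h)))))
          \<le> ereal (?C * sqrt (of_rat r) * (1 + 1 / real (Suc k)))"
        unfolding m_def[symmetric] c_def[symmetric]
      proof (rule Limsup_bounded, use mod small in eventually_elim)
        case (elim h)
        have "ln h < ln (exp (- exp 1))" using elim by (subst ln_less_cancel_iff) auto
        then have e: "exp 1 < ln (1 / h)" using elim by (simp add: ln_div)
        then have "ln (exp 1) < ln (ln (1 / h))"
          by (subst ln_less_cancel_iff) (auto intro: less_trans[OF exp_gt_zero])
        then have pos: "0 < sqrt (h * ln (ln (1 / h)))" using elim by simp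
        have h1: "h < 1" using elim by (simp add: less_le_trans[of h "exp (- exp 1)" 1])
        show ?case
        proof (rule SUP_least)
          fix t assume t: "t \<in> {0..h}"
          have "X t \<omega> < m" using t d(2)[of t] elim h1 m(1) by (cases "t = 0") auto
          then show "ereal (\<bar>X t \<omega> - X 0 \<omega>\<bar> / sqrt (h * ln (ln (1 / h)))) \<le> ereal (?C * sqrt m * c)"
            using m t h1 elim pos by (intro quotient_le[of m _ 1]) auto
        qed
      qed
    qed
  qed
  moreover have "AE \<omega> in M. Limsup (at_right 0)
      (\<lambda>h. SUP (s, t)\<in>{(s, t). s \<in> {0..T} \<and> t \<in> {0..T} \<and> \<bar>s - t\<bar> \<le> h}.
             ereal (\<bar>X s \<omega> - X t \<omega>\<bar> / sqrt (h * ln (1 / h))))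
      \<le> ereal (?C * sqrt (SUP t\<in>{0..T}. X t \<omega>))"
    if T: "0 < T" "T \<le> 1" for T
    using moduli[OF T] X0 assms(7)
  proof eventually_elim
    case (elim \<omega>)
    define S where "S = (SUP t\<in>{0..T}. X t \<omega>)"
    have "continuous_on {0..T} (\<lambda>t. X t \<omega>)"
      using elim(3) by (rule continuous_on_subset) (use T in auto)
    then have "bdd_above ((\<lambda>t. X t \<omega>) ` {0..T})"
      by (intro bounded_imp_bdd_above compact_imp_bounded compact_continuous_image) auto
    then have S: "X t \<omega> \<le> S" if "t \<in> {0..T}" for t
      unfolding S_def using that by (intro cSUP_upper)
    have "0 \<le> S" using S[of 0] elim(2) T by simp
    show ?case
      unfolding S_def[symmetric]
    proof (rule ereal_le_of_rational_approximations)
      fix r :: rat and k :: nat assume r: "S < of_rat r"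
      define m :: real where "m = of_rat r"
      define c where "c = 1 + 1 / real (Suc k)"
      let ?G = "\<lambda>t. normalized_truncation lam m T X t \<omega>"
      have "S < m" using r by (simp add: m_def)
      moreover from this have "0 < m" using \<open>0 \<le> S\<close> by linarith
      ultimately have m: "S < m" "0 < m" .
      then have "0 < r" by (simp add: m_def)
      then have mod: "\<forall>\<^sub>F h in at_right 0. \<forall>s\<in>{0..1}. \<forall>t\<in>{0..1}. \<bar>s - t\<bar> \<le> h \<longrightarrow>
          \<bar>?G s - ?G t\<bar> \<le> c * sqrt (h * ln (1 / h))"
        using elim(1) unfolding Let_def m_def c_def by auto
      have "\<forall>\<^sub>F h in at_right (0::real). h < 1"
        by (intro eventually_at_rightI[of 0 1]) auto
      then have small: "\<forall>\<^sub>F h in at_right (0::real). 0 < h \<and> h < 1"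
        using eventually_at_right_less[of "0::real"] by eventually_elim auto
      show "Limsup (at_right 0)
          (\<lambda>h. SUP (s, t)\<in>{(s, t). s \<in> {0..T} \<and> t \<in> {0..T} \<and> \<bar>s - t\<bar> \<le> h}.
             ereal (\<bar>X s \<omega> - X t \<omega>\<bar> / sqrt (h * ln (1 / h))))
          \<le> ereal (?C * sqrt (of_rat r) * (1 + 1 / real (Suc k)))"
        unfolding m_def[symmetric] c_def[symmetric]
      proof (rule Limsup_bounded, use mod small in eventually_elim)
        case (elim h)
        have pos: "0 < sqrt (h * ln (1 / h))" using elim by simp
        show ?case
        proof (rule SUP_least, clarify)
          fix s t assume st: "s \<in> {0..T}" "t \<in> {0..T}" "\<bar>s - t\<bar> \<le> h"
          then show "ereal (\<bar>X s \<omega> - X t \<omega>\<bar> / sqrt (h * ln (1 / h))) \<le> ereal (?C * sqrt m * c)"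
            using m S[of s] S[of t] elim pos T by (intro quotient_le[of m _ T]) auto
        qed
      qed
    qed
  qed
  ultimately show ?thesis by blast
qed

end
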